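(* Let $T$ be an indecomposable finite-dimensional highest weight module over $\mathcal{D}$ with $\operatorname{hw-rk} T = 1$. Then $T \simeq T(n,m)$ for some $(n,m)\in \mathbb{N}_0^2$.
   Context: $\Bbbk$ is an algebraically closed field of characteristic $0$; $\mathbb{N}_0=\{0,1,2,\dots\}$. $\mathcal{D}$ (the double of the Jordan plane) is the $\Bbbk$-algebra presented by generators $u, v, \xi, g, g^{-1}, x, y$ and relations $g g^{-1}=g^{-1}g=1$, $\xi g=g\xi$, $gx=xg$, $gy=yg+xg$, $\xi y=y\xi-2y$, $\xi x=x\xi-2x$, $ug=gu$, $vg=gv+gu$, $v\xi=\xi v-2v$, $u\xi=\xi u-2u$, $yx=xy-\tfrac12x^2$, $vu=uv-\tfrac12u^2$, $ux=xu$, $vx=xv+(1-g)+xu$, $uy=yu+(1-g)$, $vy=yv+\tfrac12 g\xi+yu$. Modules are left modules. Weights: for a $\mathcal{D}$-module $M$ and $n\in\mathbb{Z}$, $M^{(n)}=\{m\in M: (\xi-n)^a m=0 \text{ and } (g-1)^b m=0 \text{ for some } a,b\in\mathbb{N}_0\}$, and $\Pi(M)=\{n\in\mathbb{Z}: M^{(n)}\neq0\}$. $M$ is suitably graded if $M=\bigoplus_{n\in\mathbb{Z}}M^{(n)}$ with $\dim M^{(n)}<\infty$ for all $n$ (every finite-dimensional $\mathcal{D}$-module is suitably graded). If $M\neq 0$ is suitably graded and $\Pi(M)$ is bounded above, put $\operatorname{hw}M=\sup\Pi(M)$ and $\operatorname{hw-rk}M=\dim M^{(\operatorname{hw}M)}$;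 such an $M$ is a highest weight module if it is generated as a $\mathcal{D}$-module by $M^{(\operatorname{hw}M)}$. For $(n,m)\in\mathbb{N}_0^2$, $T(n,m)$ is the $\mathcal{D}$-module presented by one generator $z$ with defining relations $g\cdot z=z$, $\xi\cdot z=(n+2m)z$, $u\cdot z=0$, $v\cdot z=0$, $x^{m+1}\cdot z=0$, and $y^{n+2(m-j)+1}x^j\cdot z=0$ for all $0\le j\le m$. *)

theory Defs
  imports
    Complex_Main
    "HOL-Library.Poly_Mapping"
    "HOL-Computational_Algebra.Polynomial"
begin

section \<open>The free algebra on the letters u, v, xi, g, g inverse, x, y\<close>

datatype letter = Letter_u | Letter_v | Letter_xi | Letter_g | Letter_ginv | Letter_x | Letter_y

text \<open>
  Words form the free monoid, written additively, so that finitely supported functions on words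
  with the convolution product of \<^theory>\<open>HOL-Library.Poly_Mapping\<close> are the free algebra.
\<close>

datatype word = Word "letter list"

instantiation word :: monoid_add
begin

definition zero_word :: word where
  "0 = Word []"

fun plus_word :: "word \<Rightarrow> word \<Rightarrow> word" where
  "Word xs + Word ys = Word (xs @ ys)"

instance
proof
  fix a b c :: word
  show "a + b + c = a + (b + c)"
    by (cases a; cases b; cases c) simp
  show "0 + a = a" "a + 0 = a"
    by (cases a; simp add: zero_word_def)+
qed

end

type_synonym 'k free_algebra = "word \<Rightarrow>\<^sub>0 'k"

definition free_scalar :: "'k::field \<Rightarrow> 'k free_algebra" where
  "free_scalar c = Poly_Mapping.single 0 c"

definition free_gen :: "letter \<Rightarrow> 'k::field free_algebra" where
  "free_gen l = Poly_Mapping.single (Word [l]) 1"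


section \<open>The double of the Jordan plane\<close>

definition jd_relations :: "('k::field free_algebra \<times> 'k free_algebra) set" where
  "jd_relations =
    (let u = free_gen Letter_u; v = free_gen Letter_v; \<xi> = free_gen Letter_xi;
         g = free_gen Letter_g; g' = free_gen Letter_ginv;
         x = free_gen Letter_x; y = free_gen Letter_y;
         half = free_scalar (1 / 2)
     in {(g * g', 1), (g' * g, 1), (\<xi> * g, g * \<xi>),
         (g * x, x * g), (g * y, y * g + x * g),
         (\<xi> * y, y * \<xi> - 2 * y), (\<xi> * x, x * \<xi> - 2 * x),
         (u * g, g * u), (v * g, g * v + g * u),
         (v * \<xi>, \<xi> * v - 2 * v), (u * \<xi>, \<xi> * u - 2 * u),
         (y * x, x * y - half * x ^ 2), (v * u, u * v - half * u ^ 2),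
         (u * x, x * u), (v * x, x * v + (1 - g) + x * u),
         (u * y, y * u + (1 - g)), (v * y, y * v + half * (g * \<xi>) + y * u)})"

definition two_sided_ideal :: "'r::ring set \<Rightarrow> bool" where
  "two_sided_ideal I \<longleftrightarrow>
    0 \<in> I \<and> (\<forall>a\<in>I. \<forall>b\<in>I. a + b \<in> I) \<and> (\<forall>a\<in>I. \<forall>r. r * a \<in> I \<and> a * r \<in> I)"

definition jd_ideal :: "'k::field free_algebra set" where
  "jd_ideal = two_sided_ideal hull {p - q | p q. (p, q) \<in> jd_relations}"

lemma two_sided_ideal_jd_ideal: "two_sided_ideal jd_ideal"
  unfolding jd_ideal_def hull_def two_sided_ideal_def by blast

lemma jd_ideal_0: "0 \<in> jd_ideal"
  using two_sided_ideal_jd_ideal unfolding two_sided_ideal_def by blast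

lemma jd_ideal_add: "a \<in> jd_ideal \<Longrightarrow> b \<in> jd_ideal \<Longrightarrow> a + b \<in> jd_ideal"
  using two_sided_ideal_jd_ideal unfolding two_sided_ideal_def by blast

lemma jd_ideal_mult_left: "a \<in> jd_ideal \<Longrightarrow> r * a \<in> jd_ideal"
  using two_sided_ideal_jd_ideal unfolding two_sided_ideal_def by blast

lemma jd_ideal_mult_right: "a \<in> jd_ideal \<Longrightarrow> a * r \<in> jd_ideal"
  using two_sided_ideal_jd_ideal unfolding two_sided_ideal_def by blast

lemma jd_ideal_uminus: "a \<in> jd_ideal \<Longrightarrow> - a \<in> jd_ideal"
  using jd_ideal_mult_left[of a "- 1"] by simp

lemma jd_ideal_minus: "a \<in> jd_ideal \<Longrightarrow> b \<in> jd_ideal \<Longrightarrow> a - b \<in> jd_ideal"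
  using jd_ideal_add[of a "- b"] jd_ideal_uminus[of b] by simp

text \<open>
  The counit (u, v, xi, x, y to 0 and g to 1) vanishes on the ideal, so the quotient is nonzero
  and can be an instance of \<^class>\<open>ring_1\<close>.
\<close>

fun counit_word :: "word \<Rightarrow> 'k::field" where
  "counit_word (Word ls) = (if set ls \<subseteq> {Letter_g, Letter_ginv} then 1 else 0)"

definition free_counit :: "'k::field free_algebra \<Rightarrow> 'k" where
  "free_counit p = (\<Sum>w\<in>Poly_Mapping.keys p. Poly_Mapping.lookup p w * counit_word w)"

lemma counit_word_plus: "counit_word (a + b) = counit_word a * counit_word b"
  by (cases a; cases b) auto

lemma free_counit_superset:
  assumes "finite A" "Poly_Mapping.keys p \<subseteq> A"
  shows "free_counit p = (\<Sum>w\<in>A. Poly_Mapping.lookup p w * counit_word w)"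
  unfolding free_counit_def
  by (rule sum.mono_neutral_left) (use assms in \<open>auto simp: in_keys_iff\<close>)

lemma free_counit_single: "free_counit (Poly_Mapping.single w c) = c * counit_word w"
  by (subst free_counit_superset[of "{w}"]) (auto simp: lookup_single)

lemma free_counit_0: "free_counit 0 = 0"
  by (simp add: free_counit_def)

lemma free_counit_add: "free_counit (p + q) = free_counit p + free_counit q"
proof -
  let ?A = "Poly_Mapping.keys p \<union> Poly_Mapping.keys q"
  have "free_counit r = (\<Sum>w\<in>?A. Poly_Mapping.lookup r w * counit_word w)"
    if "Poly_Mapping.keys r \<subseteq> ?A" for r :: "'a free_algebra"
    by (rule free_counit_superset) (use that in auto)
  then show ?thesis
    using Poly_Mapping.keys_add[of p q]
    by (simp add: lookup_add ring_distribs sum.distrib)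
qed

lemma free_algebra_induct [case_names single sum]:
  fixes p :: "'k::field free_algebra"
  assumes "\<And>w c. P (Poly_Mapping.single w c)"
    and "\<And>p q. P p \<Longrightarrow> P q \<Longrightarrow> P (p + q)"
  shows "P p"
proof (induction p rule: update_induct)
  case const
  show ?case using assms(1)[of 0 0] by simp
next
  case (update f a b)
  have "Poly_Mapping.update a b f = Poly_Mapping.single a b + f"
    using update.hyps by (intro poly_mapping_eqI)
      (auto simp: lookup_update lookup_add lookup_single in_keys_iff when_def)
  then show ?case using assms update.IH by simp
qed

lemma free_counit_single_mult:
  "free_counit (Poly_Mapping.single w c * q) = free_counit (Poly_Mapping.single w c) * free_counit q"
proof (induction q rule: free_algebra_induct)
  case (single k v)
  then show ?case
    by (simp add: mult_single free_counit_single counit_word_plus)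
next
  case (sum p q)
  then show ?case
    by (simp add: ring_distribs free_counit_add)
qed

lemma free_counit_mult: "free_counit (p * q) = free_counit p * free_counit q"
proof (induction p rule: free_algebra_induct)
  case (single k v)
  show ?case by (rule free_counit_single_mult)
next
  case (sum p q)
  then show ?case
    by (simp add: ring_distribs free_counit_add)
qed

lemma free_counit_uminus: "free_counit (- p) = - free_counit p"
  using free_counit_add[of "- p" p] by (simp add: free_counit_0 eq_neg_iff_add_eq_0)

lemma free_counit_minus: "free_counit (p - q) = free_counit p - free_counit q"
  using free_counit_add[of p "- q"] by (simp add: free_counit_uminus)

lemma free_counit_1: "free_counit 1 = 1"
  unfolding single_one[symmetric] free_counit_single zero_word_def by simp

lemma one_notin_jd_ideal: "1 \<notin> jd_ideal"
proof -
  let ?K = "{p :: 'a free_algebra. free_counit p = 0}"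
  have "two_sided_ideal ?K"
    by (auto simp: two_sided_ideal_def free_counit_0 free_counit_add free_counit_mult)
  moreover have "{p - q | p q. (p, q) \<in> jd_relations} \<subseteq> ?K"
    by (auto simp: jd_relations_def Let_def free_gen_def free_scalar_def free_counit_minus
        free_counit_add free_counit_mult free_counit_single free_counit_1 power2_eq_square)
  ultimately have "jd_ideal \<subseteq> ?K"
    unfolding jd_ideal_def by (simp add: hull_minimal)
  then show ?thesis
    by (auto simp: free_counit_1)
qed

definition jd_cong :: "'k::field free_algebra \<Rightarrow> 'k free_algebra \<Rightarrow> bool" where
  "jd_cong p q \<longleftrightarrow> p - q \<in> jd_ideal"

lemma equivp_jd_cong: "equivp jd_cong"
proof (rule equivpI)
  show "reflp jd_cong"
    by (rule reflpI) (simp add: jd_cong_def jd_ideal_0)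
  show "symp jd_cong"
    by (rule sympI) (metis jd_cong_def jd_ideal_uminus minus_diff_eq)
  show "transp jd_cong"
  proof (rule transpI)
    fix p q r
    assume "jd_cong p q" "jd_cong q r"
    then have "(p - q) + (q - r) \<in> jd_ideal"
      unfolding jd_cong_def by (rule jd_ideal_add)
    then show "jd_cong p r"
      by (simp add: jd_cong_def)
  qed
qed

quotient_type (overloaded) 'k jordan_double = "'k::field free_algebra" / jd_cong
  by (rule equivp_jd_cong)

instantiation jordan_double :: (field) ring_1
begin

lift_definition zero_jordan_double :: "'a jordan_double" is 0 .
lift_definition one_jordan_double :: "'a jordan_double" is 1 .

lift_definition plus_jordan_double :: "'a jordan_double \<Rightarrow> 'a jordan_double \<Rightarrow> 'a jordan_double"
  is "(+)"
proof -
  fix p p' q q' :: "'a free_algebra"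
  assume "jd_cong p p'" "jd_cong q q'"
  then have "(p - p') + (q - q') \<in> jd_ideal"
    unfolding jd_cong_def by (rule jd_ideal_add)
  then show "jd_cong (p + q) (p' + q')"
    by (simp add: jd_cong_def add_diff_add)
qed

lift_definition uminus_jordan_double :: "'a jordan_double \<Rightarrow> 'a jordan_double"
  is uminus
proof -
  fix p p' :: "'a free_algebra"
  assume "jd_cong p p'"
  then have "- (p - p') \<in> jd_ideal"
    unfolding jd_cong_def by (rule jd_ideal_uminus)
  then show "jd_cong (- p) (- p')"
    by (simp add: jd_cong_def)
qed

lift_definition minus_jordan_double :: "'a jordan_double \<Rightarrow> 'a jordan_double \<Rightarrow> 'a jordan_double"
  is "(-)"
proof -
  fix p p' q q' :: "'a free_algebra"
  assume "jd_cong p p'" "jd_cong q q'"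
  then have "(p - p') - (q - q') \<in> jd_ideal"
    unfolding jd_cong_def by (rule jd_ideal_minus)
  then show "jd_cong (p - q) (p' - q')"
    by (simp add: jd_cong_def algebra_simps)
qed

lift_definition times_jordan_double :: "'a jordan_double \<Rightarrow> 'a jordan_double \<Rightarrow> 'a jordan_double"
  is "(*)"
proof -
  fix p p' q q' :: "'a free_algebra"
  assume "jd_cong p p'" "jd_cong q q'"
  then have "(p - p') * q + p' * (q - q') \<in> jd_ideal"
    unfolding jd_cong_def by (intro jd_ideal_add jd_ideal_mult_left jd_ideal_mult_right)
  then show "jd_cong (p * q) (p' * q')"
    by (simp add: jd_cong_def algebra_simps)
qed

instance
proof
  show "(0 :: 'a jordan_double) \<noteq> 1"
    by transfer (use jd_ideal_uminus[of "- 1"] one_notin_jd_ideal in \<open>auto simp: jd_cong_def\<close>)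
qed (transfer; simp add: jd_cong_def jd_ideal_0 algebra_simps)+

end

lift_definition jd_scalar :: "'k::field \<Rightarrow> 'k jordan_double" is free_scalar .
lift_definition jd_gen :: "letter \<Rightarrow> 'k::field jordan_double" is free_gen .

lemma jd_scalar_1: "jd_scalar 1 = 1"
  by transfer (simp add: free_scalar_def jd_cong_def jd_ideal_0)

lemma jd_scalar_add: "jd_scalar (a + b) = jd_scalar a + jd_scalar b"
  by transfer (simp add: free_scalar_def jd_cong_def jd_ideal_0 single_add)

lemma jd_scalar_mult: "jd_scalar (a * b) = jd_scalar a * jd_scalar b"
  by transfer (simp add: free_scalar_def jd_cong_def jd_ideal_0 mult_single)


section \<open>Left modules\<close>

locale left_module =
  fixes act :: "'r::ring_1 \<Rightarrow> 'm::ab_group_add \<Rightarrow> 'm"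
  assumes act_add_right: "act r (m + m') = act r m + act r m'"
    and act_add_left: "act (r + s) m = act r m + act s m"
    and act_mult: "act (r * s) m = act r (act s m)"
    and act_one: "act 1 m = m"
begin

definition submodule :: "'m set \<Rightarrow> bool" where
  "submodule N \<longleftrightarrow> 0 \<in> N \<and> (\<forall>a\<in>N. \<forall>b\<in>N. a + b \<in> N) \<and> (\<forall>r. \<forall>a\<in>N. act r a \<in> N)"

definition indecomposable :: bool where
  "indecomposable \<longleftrightarrow>
    (\<exists>m::'m. m \<noteq> 0) \<and>
    \<not> (\<exists>N N'. submodule N \<and> submodule N' \<and> N \<noteq> {0} \<and> N' \<noteq> {0} \<and>
            N \<inter> N' = {0} \<and> {a + b | a b. a \<in> N \<and> b \<in> N'} = UNIV)"

end

text \<open>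
  In \<^locale>\<open>left_module\<close> the module is the whole type. Quotients of the regular module depend on
  parameters, so isomorphism is stated for modules with explicit carriers.
\<close>

definition left_module_iso ::
  "'a set \<Rightarrow> ('a \<Rightarrow> 'a \<Rightarrow> 'a) \<Rightarrow> ('r \<Rightarrow> 'a \<Rightarrow> 'a) \<Rightarrow> 'b set \<Rightarrow> ('b \<Rightarrow> 'b \<Rightarrow> 'b) \<Rightarrow> ('r \<Rightarrow> 'b \<Rightarrow> 'b) \<Rightarrow> bool"
  where
  "left_module_iso A addA actA B addB actB \<longleftrightarrow>
    (\<exists>f. bij_betw f A B \<and>
         (\<forall>a\<in>A. \<forall>a'\<in>A. f (addA a a') = addB (f a) (f a')) \<and>
         (\<forall>r. \<forall>a\<in>A. f (actA r a) = actB r (f a)))"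

definition left_ideal :: "'r::ring_1 set \<Rightarrow> bool" where
  "left_ideal J \<longleftrightarrow> left_module.submodule (*) J"

text \<open>
  The quotient of the regular left module by a left ideal, as a set of cosets. For the left ideal
  generated by a set S this is the module presented by one generator (the coset of 1) and the
  relations saying that the elements of S annihilate that generator.
\<close>

definition coset_rel :: "'r::ring_1 set \<Rightarrow> ('r \<times> 'r) set" where
  "coset_rel J = {(a, b). a - b \<in> J}"

definition coset_carrier :: "'r::ring_1 set \<Rightarrow> 'r set set" where
  "coset_carrier J = UNIV // coset_rel J"

definition coset_add :: "'r::ring_1 set \<Rightarrow> 'r set \<Rightarrow> 'r set \<Rightarrow> 'r set" where
  "coset_add J A B = (\<Union>a\<in>A. \<Union>b\<in>B. coset_rel J `` {a + b})"

definition coset_act :: "'r::ring_1 set \<Rightarrow> 'r \<Rightarrow> 'r set \<Rightarrow> 'r set" where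
  "coset_act J r A = (\<Union>a\<in>A. coset_rel J `` {r * a})"

lemma left_module_regular: "left_module ((*) :: 'r::ring_1 \<Rightarrow> 'r \<Rightarrow> 'r)"
  by standard (simp_all add: algebra_simps)

lemma left_ideal_iff:
  "left_ideal J \<longleftrightarrow> 0 \<in> J \<and> (\<forall>a\<in>J. \<forall>b\<in>J. a + b \<in> J) \<and> (\<forall>r. \<forall>a\<in>J. r * a \<in> J)"
  unfolding left_ideal_def left_module.submodule_def[OF left_module_regular] ..

lemma left_ideal_hull: "left_ideal (left_ideal hull S)"
  unfolding hull_def left_ideal_iff by blast

lemma left_ideal_uminus: "left_ideal J \<Longrightarrow> a \<in> J \<Longrightarrow> - a \<in> J"
  unfolding left_ideal_iff by (metis mult_minus1)

lemma equiv_coset_rel: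
  assumes "left_ideal J"
  shows "equiv UNIV (coset_rel J)"
proof (rule equivI)
  show "refl (coset_rel J)"
    using assms by (auto simp: refl_on_def coset_rel_def left_ideal_iff)
  show "sym (coset_rel J)"
    using left_ideal_uminus[OF assms] by (force simp: sym_def coset_rel_def)
  show "trans (coset_rel J)"
  proof (rule transI)
    fix a b c
    assume "(a, b) \<in> coset_rel J" "(b, c) \<in> coset_rel J"
    then have "(a - b) + (b - c) \<in> J"
      using assms by (simp only: coset_rel_def left_ideal_iff mem_Collect_eq prod.case)
    then show "(a, c) \<in> coset_rel J"
      by (simp add: coset_rel_def)
  qed
qed auto

lemma coset_add_coset:
  assumes "left_ideal J"
  shows "coset_add J (coset_rel J `` {a}) (coset_rel J `` {b}) = coset_rel J `` {a + b}"
  unfolding coset_add_def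
proof (rule UN_equiv_class2[OF equiv_coset_rel equiv_coset_rel])
  show "congruent2 (coset_rel J) (coset_rel J) (\<lambda>a b. coset_rel J `` {a + b})"
  proof (rule congruent2I')
    fix a a' b b'
    assume "(a, a') \<in> coset_rel J" "(b, b') \<in> coset_rel J"
    then have "(a - a') + (b - b') \<in> J"
      using assms by (simp only: coset_rel_def left_ideal_iff mem_Collect_eq prod.case)
    then have "(a + b, a' + b') \<in> coset_rel J"
      by (simp add: coset_rel_def algebra_simps)
    then show "coset_rel J `` {a + b} = coset_rel J `` {a' + b'}"
      by (rule equiv_class_eq[OF equiv_coset_rel[OF assms]])
  qed
qed (use assms in auto)

lemma coset_act_coset:
  assumes "left_ideal J"
  shows "coset_act J r (coset_rel J `` {a}) = coset_rel J `` {r * a}"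
  unfolding coset_act_def
proof (rule UN_equiv_class[OF equiv_coset_rel])
  show "(\<lambda>a. coset_rel J `` {r * a}) respects coset_rel J"
  proof (rule congruentI)
    fix a b
    assume "(a, b) \<in> coset_rel J"
    then have "r * (a - b) \<in> J"
      using assms by (simp add: coset_rel_def left_ideal_iff)
    then have "(r * a, r * b) \<in> coset_rel J"
      by (simp add: coset_rel_def algebra_simps)
    then show "coset_rel J `` {r * a} = coset_rel J `` {r * b}"
      by (rule equiv_class_eq[OF equiv_coset_rel[OF assms]])
  qed
qed (use assms in auto)


section \<open>Modules over the double of the Jordan plane\<close>

locale jordan_double_module = left_module act
  for act :: "'k::field jordan_double \<Rightarrow> 'm::ab_group_add \<Rightarrow> 'm"
begin

definition scale :: "'k \<Rightarrow> 'm \<Rightarrow> 'm" where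
  "scale c m = act (jd_scalar c) m"

sublocale vector_space scale
  by standard
    (simp_all add: scale_def act_add_right act_add_left act_mult act_one
      jd_scalar_add jd_scalar_mult jd_scalar_1)

definition finite_dim :: "'m set \<Rightarrow> bool" where
  "finite_dim V \<longleftrightarrow> (\<exists>B. finite B \<and> span B = V)"

definition weight_space :: "int \<Rightarrow> 'm set" where
  "weight_space n =
    {m. (\<exists>a::nat. act ((jd_gen Letter_xi - of_int n) ^ a) m = 0) \<and>
        (\<exists>b::nat. act ((jd_gen Letter_g - 1) ^ b) m = 0)}"

definition weights :: "int set" where
  "weights = {n. weight_space n \<noteq> {0}}"

definition suitably_graded :: bool where
  "suitably_graded \<longleftrightarrow>
    (\<forall>m. \<exists>!f. (\<forall>n. f n \<in> weight_space n) \<and> finite {n. f n \<noteq> 0} \<and>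
             m = (\<Sum>n | f n \<noteq> 0. f n)) \<and>
    (\<forall>n. finite_dim (weight_space n))"

definition hw :: int where
  "hw = Sup weights"

definition hw_rk :: nat where
  "hw_rk = dim (weight_space hw)"

definition highest_weight_module :: bool where
  "highest_weight_module \<longleftrightarrow>
    (\<exists>m::'m. m \<noteq> 0) \<and> suitably_graded \<and> bdd_above weights \<and>
    submodule hull (weight_space hw) = UNIV"

end


section \<open>The modules T(n,m)\<close>

definition T_relators :: "nat \<Rightarrow> nat \<Rightarrow> 'k::field jordan_double set" where
  "T_relators n m =
    {jd_gen Letter_g - 1, jd_gen Letter_xi - of_nat (n + 2 * m),
     jd_gen Letter_u, jd_gen Letter_v, jd_gen Letter_x ^ (m + 1)} \<union>
    {jd_gen Letter_y ^ (n + 2 * (m - j) + 1) * jd_gen Letter_x ^ j | j. j \<le> m}"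

definition T_ideal :: "nat \<Rightarrow> nat \<Rightarrow> 'k::field jordan_double set" where
  "T_ideal n m = left_ideal hull T_relators n m"

end

theory Submission
  imports Defs
begin

text \<open>
  Let \<open>z\<close> span the top weight space, of weight \<open>N\<close>. Then \<open>z\<close> is fixed by \<open>g\<close>, killed by \<open>u\<close> and \<open>v\<close>, and
  generates \<open>T\<close>, so \<open>T\<close> is the quotient of the algebra by the annihilator \<open>J\<close> of \<open>z\<close>. It remains to show
  that such a left ideal \<open>J\<close> is the defining ideal of some \<open>T(n,m)\<close>.

  The quotient by \<open>J\<close> is spanned by the monomials \<open>y\<^sup>i x\<^sup>k\<close>. The relations show that each \<open>x\<^sup>k\<close> is again
  a highest weight vector, of weight \<open>N - 2k\<close>, and that in the filtration by the submodules
  generated by the powers \<open>x\<^sup>k\<close> the elements \<open>x\<close>, \<open>u\<close> and \<open>g - 1\<close> go one step deeper. The graded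
  pieces are therefore highest weight modules over the Lie algebra \<open>sl\<^sub>2\<close> spanned by the
  images of \<open>v\<close>, \<open>\<xi>\<close>, \<open>y\<close>. Since \<open>T\<close> is finite-dimensional, the piece generated by a nonzero \<open>x\<^sup>k\<close> has
  \<open>N - 2k \<ge> 0\<close> and basis \<open>y\<^sup>i x\<^sup>k\<close> with \<open>0 \<le> i \<le> N - 2k\<close> (\<open>string_length\<close>). Let \<open>m\<close> be the largest exponent
  with \<open>x\<^sup>m z \<noteq> 0\<close> and put \<open>n = N - 2m\<close>.

  The next power of \<open>y\<close> at first vanishes only modulo the deeper pieces; but its weight
  lies below all weights of these pieces, so it is zero in \<open>T\<close> (\<open>monomial_mem\<close>). Thus \<open>z\<close> satisfies the
  defining relations of \<open>T(n,m)\<close>. These relations leave only the monomials with \<open>k \<le> m\<close> and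
  \<open>i \<le> n + 2(m - k)\<close> to span \<open>T(n,m)\<close>, and exactly these are independent in \<open>T\<close>, by the description of
  the graded pieces and the separation of weights (\<open>monomials_independent\<close>). Hence the surjection from
  \<open>T(n,m)\<close> onto \<open>T\<close> is injective (\<open>eq_T_ideal\<close>).
\<close>

section \<open>Relations, scalars and generation in the double of the Jordan plane\<close>

abbreviation Du :: "'k::field jordan_double" where "Du \<equiv> jd_gen Letter_u"
abbreviation Dv :: "'k::field jordan_double" where "Dv \<equiv> jd_gen Letter_v"
abbreviation Dxi :: "'k::field jordan_double" where "Dxi \<equiv> jd_gen Letter_xi"
abbreviation Dg :: "'k::field jordan_double" where "Dg \<equiv> jd_gen Letter_g"
abbreviation Dginv :: "'k::field jordan_double" where "Dginv \<equiv> jd_gen Letter_ginv"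
abbreviation Dx :: "'k::field jordan_double" where "Dx \<equiv> jd_gen Letter_x"
abbreviation Dy :: "'k::field jordan_double" where "Dy \<equiv> jd_gen Letter_y"

lemma abs_jordan_double_relation:
  assumes "(p, q) \<in> jd_relations"
  shows "abs_jordan_double p = abs_jordan_double q"
  unfolding jordan_double.abs_eq_iff jd_cong_def jd_ideal_def
  by (rule hull_inc) (use assms in blast)

lemmas abs_jordan_double_simps =
  plus_jordan_double.abs_eq[symmetric] minus_jordan_double.abs_eq[symmetric]
  times_jordan_double.abs_eq[symmetric] one_jordan_double_def[symmetric]
  jd_gen.abs_eq[symmetric] jd_scalar.abs_eq[symmetric]

text \<open>
  The relations are multiplied by an arbitrary \<open>p\<close> on the right and oriented so that \<open>g\<close>, \<open>u\<close>, \<open>v\<close>, \<open>\<xi>\<close>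
  move to the right past \<open>y\<close> and \<open>x\<close>, and \<open>x\<close> past \<open>y\<close>. In this form they rewrite
  right-nested products towards the monomials \<open>y\<^sup>i x\<^sup>k\<close> and are compatible with associativity
  as a rewrite rule.
\<close>
lemma jordan_double_relations:
  fixes p :: "'k::field jordan_double"
  shows Dginv_Dg: "Dginv * (Dg * p) = p"
    and Dxi_Dg: "Dxi * (Dg * p) = Dg * (Dxi * p)"
    and Dg_Dx: "Dg * (Dx * p) = Dx * (Dg * p)"
    and Dg_Dy: "Dg * (Dy * p) = Dy * (Dg * p) + Dx * (Dg * p)"
    and Dxi_Dy: "Dxi * (Dy * p) = Dy * (Dxi * p) - 2 * (Dy * p)"
    and Dxi_Dx: "Dxi * (Dx * p) = Dx * (Dxi * p) - 2 * (Dx * p)"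
    and Dg_Du: "Dg * (Du * p) = Du * (Dg * p)"
    and Dg_Dv: "Dg * (Dv * p) = Dv * (Dg * p) - Dg * (Du * p)"
    and Dxi_Dv: "Dxi * (Dv * p) = Dv * (Dxi * p) + 2 * (Dv * p)"
    and Dxi_Du: "Dxi * (Du * p) = Du * (Dxi * p) + 2 * (Du * p)"
    and Dx_Dy: "Dx * (Dy * p) = Dy * (Dx * p) + jd_scalar (1 / 2) * (Dx * (Dx * p))"
    and Du_Dx: "Du * (Dx * p) = Dx * (Du * p)"
    and Dv_Dx: "Dv * (Dx * p) = Dx * (Dv * p) + (p - Dg * p) + Dx * (Du * p)"
    and Du_Dy: "Du * (Dy * p) = Dy * (Du * p) + (p - Dg * p)"
    and Dv_Dy: "Dv * (Dy * p) = Dy * (Dv * p) + jd_scalar (1 / 2) * (Dg * (Dxi * p)) + Dy * (Du * p)"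
proof -
  have "\<forall>(p, q) \<in> (jd_relations :: ('k free_algebra \<times> 'k free_algebra) set).
      abs_jordan_double p = abs_jordan_double q"
    using abs_jordan_double_relation by blast
  note rels = this[unfolded jd_relations_def Let_def ball_simps prod.case mult_2 power2_eq_square
    abs_jordan_double_simps]
  have *: "a * (b * p) = c * p" if "a * b = c" for a b c :: "'k jordan_double"
    using that by (simp add: mult.assoc[symmetric])
  have base:
    "Dg * Dginv = (1 :: 'k jordan_double)"
    "Dginv * Dg = (1 :: 'k jordan_double)"
    "Dxi * Dg = (Dg * Dxi :: 'k jordan_double)"
    "Dg * Dx = (Dx * Dg :: 'k jordan_double)"
    "Dg * Dy = (Dy * Dg + Dx * Dg :: 'k jordan_double)"
    "Dxi * Dy = (Dy * Dxi - 2 * Dy :: 'k jordan_double)"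
    "Dxi * Dx = (Dx * Dxi - 2 * Dx :: 'k jordan_double)"
    "Du * Dg = (Dg * Du :: 'k jordan_double)"
    "Dv * Dg = (Dg * Dv + Dg * Du :: 'k jordan_double)"
    "Dv * Dxi = (Dxi * Dv - 2 * Dv :: 'k jordan_double)"
    "Du * Dxi = (Dxi * Du - 2 * Du :: 'k jordan_double)"
    "Dy * Dx = (Dx * Dy - jd_scalar (1 / 2) * (Dx * Dx) :: 'k jordan_double)"
    "Du * Dx = (Dx * Du :: 'k jordan_double)"
    "Dv * Dx = (Dx * Dv + (1 - Dg) + Dx * Du :: 'k jordan_double)"
    "Du * Dy = (Dy * Du + (1 - Dg) :: 'k jordan_double)"
    "Dv * Dy = (Dy * Dv + jd_scalar (1 / 2) * (Dg * Dxi) + Dy * Du :: 'k jordan_double)"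
    using rels by (simp_all only: mult_2)
  show "Dginv * (Dg * p) = p"
    using base(2)[THEN *] by (simp add: algebra_simps)
  show "Dxi * (Dg * p) = Dg * (Dxi * p)"
    using base(3)[THEN *] by (simp add: algebra_simps)
  show "Dg * (Dx * p) = Dx * (Dg * p)"
    using base(4)[THEN *] by (simp add: algebra_simps)
  show "Dg * (Dy * p) = Dy * (Dg * p) + Dx * (Dg * p)"
    using base(5)[THEN *] by (simp add: algebra_simps)
  show "Dxi * (Dy * p) = Dy * (Dxi * p) - 2 * (Dy * p)"
    using base(6)[THEN *] by (simp add: algebra_simps)
  show "Dxi * (Dx * p) = Dx * (Dxi * p) - 2 * (Dx * p)"
    using base(7)[THEN *] by (simp add: algebra_simps)
  show "Dg * (Du * p) = Du * (Dg * p)"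
    using base(8)[THEN *] by (simp add: algebra_simps)
  show "Dg * (Dv * p) = Dv * (Dg * p) - Dg * (Du * p)"
    using base(9)[THEN *] by (simp add: algebra_simps)
  show "Dxi * (Dv * p) = Dv * (Dxi * p) + 2 * (Dv * p)"
    using base(10)[THEN *] by (simp add: algebra_simps)
  show "Dxi * (Du * p) = Du * (Dxi * p) + 2 * (Du * p)"
    using base(11)[THEN *] by (simp add: algebra_simps)
  show "Dx * (Dy * p) = Dy * (Dx * p) + jd_scalar (1 / 2) * (Dx * (Dx * p))"
    using base(12)[THEN *] by (simp add: algebra_simps)
  show "Du * (Dx * p) = Dx * (Du * p)"
    using base(13)[THEN *] by (simp add: algebra_simps)
  show "Dv * (Dx * p) = Dx * (Dv * p) + (p - Dg * p) + Dx * (Du * p)"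
    using base(14)[THEN *] by (simp add: algebra_simps)
  show "Du * (Dy * p) = Dy * (Du * p) + (p - Dg * p)"
    using base(15)[THEN *] by (simp add: algebra_simps)
  show "Dv * (Dy * p) = Dy * (Dv * p) + jd_scalar (1 / 2) * (Dg * (Dxi * p)) + Dy * (Du * p)"
    using base(16)[THEN *] by (simp add: algebra_simps)
qed

text \<open>
  The double is spanned by words in the generators, so a property stable under sums, scalars and
  left multiplication by generators follows from its validity at \<open>1\<close>.
\<close>
lemma jordan_double_induct [case_names one add scale gen]:
  fixes r :: "'k::field jordan_double"
  assumes one: "P 1"
    and add: "\<And>p q. P p \<Longrightarrow> P q \<Longrightarrow> P (p + q)"
    and scale: "\<And>c p. P p \<Longrightarrow> P (jd_scalar c * p)"
    and gen: "\<And>l p. P p \<Longrightarrow> P (jd_gen l * p)"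
  shows "P r"
proof (induction r rule: jordan_double.abs_induct)
  case (1 p)
  show ?case
  proof (induction p rule: free_algebra_induct)
    case (single w c)
    obtain ls where w: "w = Word ls" by (cases w)
    have "P (abs_jordan_double (Poly_Mapping.single (Word ls) c))"
    proof (induction ls)
      case Nil
      have "Poly_Mapping.single (Word []) c = free_scalar c * 1"
        by (simp add: free_scalar_def zero_word_def)
      then show ?case
        using scale[OF one, of c] by (simp only: abs_jordan_double_simps)
    next
      case (Cons l ls)
      have "Poly_Mapping.single (Word (l # ls)) c = free_gen l * Poly_Mapping.single (Word ls) c"
        by (simp add: free_gen_def mult_single)
      then show ?case
        using gen[OF Cons.IH] by (simp only: abs_jordan_double_simps)
    qed
    then show ?case by (simp add: w)
  next
    case (sum p q)
    then show ?case using add by (simp only: abs_jordan_double_simps)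
  qed
qed

text \<open>
  The scalars are central. This is what makes left multiplications linear maps of the regular
  module and lets scalars be moved out of products below.
\<close>
lemma jd_scalar_commute: "jd_scalar c * r = r * jd_scalar c"
proof (induction r rule: jordan_double_induct)
  case one
  show ?case by simp
next
  case (add p q)
  then show ?case by (simp add: algebra_simps)
next
  case (scale d p)
  then show ?case by (metis jd_scalar_mult mult.assoc mult.commute)
next
  case (gen l p)
  have "jd_scalar c * jd_gen l = jd_gen l * jd_scalar c"
    by transfer (simp add: free_scalar_def free_gen_def mult_single jd_cong_def jd_ideal_0)
  then show ?case using gen by (metis mult.assoc)
qed

interpretation regular: jordan_double_module "(*) :: 'k::field jordan_double \<Rightarrow> _"
  by (rule jordan_double_module.intro) (rule left_module_regular)

lemma jd_scalar_0 [simp]: "jd_scalar 0 = 0"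
  using jd_scalar_add[of 0 0] by simp

lemma jd_scalar_minus: "jd_scalar (- c) = - jd_scalar c"
  using jd_scalar_add[of c "- c"] by (simp add: eq_neg_iff_add_eq_0 add.commute)

lemma jd_scalar_of_nat [simp]: "jd_scalar (of_nat n) = of_nat n"
  by (induction n) (simp_all add: jd_scalar_add jd_scalar_1)

lemma jd_scalar_of_int [simp]: "jd_scalar (of_int n) = of_int n"
  by (cases n) (simp_all add: jd_scalar_minus del: of_nat_Suc)

lemma regular_scale_mult_right: "r * regular.scale c p = regular.scale c (r * p)"
  by (metis jd_scalar_commute mult.assoc regular.scale_def)

lemma subspace_left_ideal:
  assumes "left_ideal J"
  shows "regular.subspace J"
  using assms by (simp add: left_ideal_iff regular.subspace_def regular.scale_def)

section \<open>Straightening modulo a highest weight left ideal\<close>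

text \<open>
  The left ideals \<open>J\<close> here are those for which the coset of \<open>1\<close> in the quotient by \<open>J\<close> zero or a
  highest weight vector of weight \<open>N\<close>. Both the annihilator of a highest weight vector and the defining
  ideal of \<open>T(n,m)\<close> with \<open>N = n + 2m\<close> are of this kind, so what follows applies to both.
\<close>
locale highest_weight_ideal =
  fixes J :: "'k::field_char_0 jordan_double set" and N :: int
  assumes left_ideal: "left_ideal J"
    and Dg_mem: "Dg - 1 \<in> J"
    and Dxi_mem: "Dxi - of_int N \<in> J"
    and Du_mem: "Du \<in> J"
    and Dv_mem: "Dv \<in> J"
begin

lemma mult_mem: "p \<in> J \<Longrightarrow> r * p \<in> J"
  using left_ideal by (simp add: left_ideal_iff)

lemma add_mem: "p \<in> J \<Longrightarrow> q \<in> J \<Longrightarrow> p + q \<in> J"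
  using left_ideal by (simp add: left_ideal_iff)

lemma diff_mem: "p \<in> J \<Longrightarrow> q \<in> J \<Longrightarrow> p - q \<in> J"
  by (rule regular.subspace_diff[OF subspace_left_ideal[OF left_ideal]])

lemma span_J: "regular.span J = J"
  using subspace_left_ideal[OF left_ideal] by (simp add: regular.span_eq_iff)

text \<open>
  The image of \<open>layer j t\<close> in the quotient by \<open>J\<close> is the part of weight \<open>N - 2t\<close> of the submodule
  generated by \<open>x\<^sup>j\<close>. The index \<open>j\<close> filters by powers of \<open>x\<close>. The degree \<open>t\<close> is an integer because
  \<open>u\<close> and \<open>v\<close> lower it by one: in negative degree the layer is just \<open>J\<close>.
\<close>
definition layer :: "nat \<Rightarrow> int \<Rightarrow> 'k jordan_double set" where
  "layer j t = regular.span (J \<union> {Dy ^ i * Dx ^ k | i k. j \<le> k \<and> int (i + k) = t})"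

lemma J_subset_layer: "p \<in> J \<Longrightarrow> p \<in> layer j t"
  by (simp add: layer_def regular.span_base)

lemma monomial_in_layer: "j \<le> k \<Longrightarrow> int (i + k) = t \<Longrightarrow> Dy ^ i * Dx ^ k \<in> layer j t"
  unfolding layer_def by (rule regular.span_base) blast

lemma layer_antimono: "j \<le> j' \<Longrightarrow> p \<in> layer j' t \<Longrightarrow> p \<in> layer j t"
  unfolding layer_def by (erule rev_subsetD[OF _ regular.span_mono]) (blast intro: order_trans)

lemma layer_add: "p \<in> layer j t \<Longrightarrow> q \<in> layer j t \<Longrightarrow> p + q \<in> layer j t"
  unfolding layer_def by (rule regular.span_add)

lemma layer_diff: "p \<in> layer j t \<Longrightarrow> q \<in> layer j t \<Longrightarrow> p - q \<in> layer j t"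
  unfolding layer_def by (rule regular.span_diff)

lemma layer_scale: "p \<in> layer j t \<Longrightarrow> jd_scalar c * p \<in> layer j t"
  unfolding layer_def regular.scale_def[symmetric] by (rule regular.span_scale)

lemma layer_cancel_scalar:
  assumes "jd_scalar c * p \<in> layer j t" "c \<noteq> 0"
  shows "p \<in> layer j t"
proof -
  have "jd_scalar (inverse c) * (jd_scalar c * p) = jd_scalar (inverse c * c) * p"
    by (simp only: jd_scalar_mult mult.assoc)
  also have "\<dots> = p" using \<open>c \<noteq> 0\<close> by (simp add: jd_scalar_1)
  finally show ?thesis using layer_scale[OF assms(1), of "inverse c"] by simp
qed

lemma layer_eq_J: "t < int j \<Longrightarrow> layer j t = J"
proof -
  assume "t < int j"
  then have "{Dy ^ i * Dx ^ k | i k. j \<le> k \<and> int (i + k) = t} = ({} :: 'k jordan_double set)"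
    by auto
  then show ?thesis unfolding layer_def by (simp only: Un_empty_right span_J)
qed

lemma cancel_scalar_mem:
  assumes "jd_scalar c * p \<in> J" "c \<noteq> 0"
  shows "p \<in> J"
  \<comment> \<open>In degree \<open>- 1\<close> the layer is \<open>J\<close> itself.\<close>
  using layer_cancel_scalar[of c p 0 "- 1"] assms layer_eq_J[of "- 1" 0] by simp

lemma mult_layer:
  assumes p: "p \<in> layer j t"
    and monomials: "\<And>i k. j \<le> k \<Longrightarrow> int (i + k) = t \<Longrightarrow> r * (Dy ^ i * Dx ^ k) \<in> layer j' t'"
  shows "r * p \<in> layer j' t'"
proof (rule regular.span_induct[OF p[unfolded layer_def]])
  show "regular.subspace {p. r * p \<in> layer j' t'}"
  proof (rule regular.subspaceI)
    show "0 \<in> {p. r * p \<in> layer j' t'}"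
      by (simp add: layer_def regular.span_zero)
    show "p + q \<in> {p. r * p \<in> layer j' t'}"
      if "p \<in> {p. r * p \<in> layer j' t'}" "q \<in> {p. r * p \<in> layer j' t'}" for p q
      using that by (simp add: distrib_left layer_add)
    show "regular.scale c p \<in> {p. r * p \<in> layer j' t'}"
      if "p \<in> {p. r * p \<in> layer j' t'}" for c p
      using that by (simp only: mem_Collect_eq regular_scale_mult_right) (simp add: regular.scale_def layer_scale)
  qed
next
  fix q assume "q \<in> J \<union> {Dy ^ i * Dx ^ k | i k. j \<le> k \<and> int (i + k) = t}"
  then consider "q \<in> J" | i k where "q = Dy ^ i * Dx ^ k" "j \<le> k" "int (i + k) = t"
    by blast
  then show "r * q \<in> layer j' t'"
  proof cases
    case 1
    then show ?thesis by (intro J_subset_layer mult_mem)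
  next
    case 2
    then show ?thesis by (simp only: monomials)
  qed
qed

lemma Dy_layer:
  assumes "p \<in> layer j t"
  shows "Dy * p \<in> layer j (t + 1)"
  using assms
proof (rule mult_layer)
  fix i k assume "j \<le> k" "int (i + k) = t"
  then show "Dy * (Dy ^ i * Dx ^ k) \<in> layer j (t + 1)"
    using monomial_in_layer[of j k "Suc i" "t + 1"] by (simp add: mult.assoc)
qed

text \<open>
  The relation \<open>xy = yx + \<onehalf>x\<^sup>2\<close> never decreases the number of letters \<open>x\<close>. The correction term
  \<open>\<onehalf>x\<cdot>(x y\<^sup>a x\<^sup>k)\<close> still has an \<open>x\<close> on the left, but by induction it meets only monomials with at
  most \<open>a\<close> letters \<open>y\<close>; hence the strong induction on the exponent of \<open>y\<close>.
\<close>
lemma Dx_monomial: "Dx * (Dy ^ i * Dx ^ k) \<in> layer (Suc k) (int (i + k) + 1)"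
proof (induction i arbitrary: k rule: less_induct)
  case (less i)
  show ?case
  proof (cases i)
    case 0
    then show ?thesis using monomial_in_layer[of "Suc k" "Suc k" 0] by (simp add: add.commute)
  next
    case (Suc a)
    define q :: "'k jordan_double" where "q = Dx * (Dy ^ a * Dx ^ k)"
    have q: "q \<in> layer (Suc k) (int (a + k) + 1)"
      unfolding q_def by (rule less.IH) (simp add: Suc)
    have "Dx * q \<in> layer (Suc k) (int (a + k) + 2)"
      using q
    proof (rule mult_layer)
      fix i' k' assume i'k': "Suc k \<le> k'" "int (i' + k') = int (a + k) + 1"
      then have "Dx * (Dy ^ i' * Dx ^ k') \<in> layer (Suc k') (int (i' + k') + 1)"
        by (intro less.IH) (simp add: Suc)
      also have "int (i' + k') + 1 = int (a + k) + 2"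
        using i'k' by simp
      finally show "Dx * (Dy ^ i' * Dx ^ k') \<in> layer (Suc k) (int (a + k) + 2)"
        by (rule layer_antimono[rotated]) (use i'k' in simp)
    qed
    then have "Dy * q + jd_scalar (1 / 2) * (Dx * q) \<in> layer (Suc k) (int (a + k) + 2)"
      using Dy_layer[OF q] by (intro layer_add layer_scale) (simp_all add: add.assoc)
    also have "Dy * q + jd_scalar (1 / 2) * (Dx * q) = Dx * (Dy ^ i * Dx ^ k)"
      by (simp add: q_def Suc mult.assoc Dx_Dy)
    finally show ?thesis by (simp add: Suc add.commute)
  qed
qed

lemma Dx_layer:
  assumes "p \<in> layer j t"
  shows "Dx * p \<in> layer (Suc j) (t + 1)"
  using assms
proof (rule mult_layer)
  fix i k assume "j \<le> k" "int (i + k) = t"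
  then show "Dx * (Dy ^ i * Dx ^ k) \<in> layer (Suc j) (t + 1)"
    using Dx_monomial[of i k] layer_antimono[of "Suc j" "Suc k"] by simp
qed

lemma Dg_Dx_power: "Dg * Dx ^ k = Dx ^ k * (Dg :: 'k jordan_double)"
proof (induction k)
  case (Suc k)
  then show ?case by (metis Dg_Dx mult.assoc power_Suc)
qed simp

lemma Du_Dx_power: "Du * Dx ^ k = Dx ^ k * (Du :: 'k jordan_double)"
proof (induction k)
  case (Suc k)
  then show ?case by (metis Du_Dx mult.assoc power_Suc)
qed simp

text \<open>
  On the graded pieces of the filtration by powers of \<open>x\<close> the element \<open>g\<close> is the identity: \<open>g\<close> fixes
  \<open>x\<^sup>k\<close> modulo \<open>J\<close>, and passing a letter \<open>y\<close> changes \<open>g\<close> by \<open>xg\<close>, which lies one step deeper. As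
  \<open>x\<close> and \<open>u\<close> are zero on the graded pieces, only the action of \<open>sl\<^sub>2\<close> by \<open>v\<close>, \<open>\<xi>\<close>, \<open>y\<close>
  remains there.
\<close>
lemma Dg_monomial: "(Dg - 1) * (Dy ^ i * Dx ^ k) \<in> layer (Suc k) (int (i + k))"
proof (induction i)
  case 0
  have "Dx ^ k * (Dg - 1) \<in> J" by (rule mult_mem[OF Dg_mem])
  then show ?case by (simp add: J_subset_layer algebra_simps Dg_Dx_power)
next
  case (Suc i)
  define p where "p = Dy ^ i * (Dx ^ k :: 'k jordan_double)"
  have q: "(Dg - 1) * p \<in> layer (Suc k) (int (i + k))" using Suc by (simp add: p_def)
  have p: "p \<in> layer k (int (i + k))" unfolding p_def by (rule monomial_in_layer) auto
  have "(Dg - 1) * (Dy * p) = Dy * ((Dg - 1) * p) + Dx * ((Dg - 1) * p) + Dx * p"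
    by (simp add: Dg_Dy algebra_simps)
  also have "\<dots> \<in> layer (Suc k) (int (i + k) + 1)"
    using layer_antimono[OF _ q, of k] by (intro layer_add Dx_layer Dy_layer p q) simp_all
  finally show ?case by (simp add: p_def mult.assoc add.commute)
qed

lemma Dg_layer:
  assumes "p \<in> layer j t"
  shows "(Dg - 1) * p \<in> layer (Suc j) t"
  using assms
proof (rule mult_layer)
  fix i k assume "j \<le> k" "int (i + k) = t"
  then show "(Dg - 1) * (Dy ^ i * Dx ^ k) \<in> layer (Suc j) t"
    using Dg_monomial[of i k] layer_antimono[of "Suc j" "Suc k"] by simp
qed

text \<open>
  With \<open>h\<close> the inverse of \<open>g\<close>, one has \<open>h p = p - h (g - 1) p\<close>: the factor \<open>g - 1\<close> goes one step
  deeper into the filtration, which ends at \<open>J\<close> once \<open>j\<close> exceeds \<open>t\<close>.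
\<close>
lemma Dginv_layer:
  assumes "p \<in> layer j t"
  shows "Dginv * p \<in> layer j t"
  using assms
proof (induction "nat (t + 1) - j" arbitrary: j p)
  case 0
  then have "t < int j" by simp
  then show ?case using 0 mult_mem by (simp add: layer_eq_J)
next
  case (Suc d)
  have "Dginv * ((Dg - 1) * p) \<in> layer (Suc j) t"
    using Suc.hyps by (intro Suc.hyps Dg_layer Suc.prems) simp
  then have "p - Dginv * ((Dg - 1) * p) \<in> layer j t"
    using Suc.prems layer_antimono[of j "Suc j"] by (intro layer_diff) auto
  also have "p - Dginv * ((Dg - 1) * p) = Dginv * p"
    by (simp add: Dginv_Dg algebra_simps)
  finally show ?case .
qed

lemma Du_monomial: "Du * (Dy ^ i * Dx ^ k) \<in> layer (Suc k) (int (i + k) - 1)"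
proof (induction i)
  case 0
  have "Dx ^ k * Du \<in> J" by (rule mult_mem[OF Du_mem])
  then show ?case by (simp add: J_subset_layer Du_Dx_power)
next
  case (Suc i)
  define p where "p = Dy ^ i * (Dx ^ k :: 'k jordan_double)"
  have q: "Du * p \<in> layer (Suc k) (int (i + k) - 1)" using Suc by (simp add: p_def)
  have p: "p \<in> layer k (int (i + k))" unfolding p_def by (rule monomial_in_layer) auto
  have "Du * (Dy * p) = Dy * (Du * p) - (Dg - 1) * p"
    by (simp add: Du_Dy algebra_simps)
  also have "\<dots> \<in> layer (Suc k) (int (i + k))"
    using Dy_layer[OF q] Dg_layer[OF p] by (intro layer_diff) simp_all
  finally show ?case by (simp add: p_def mult.assoc add.commute)
qed

lemma Du_layer:
  assumes "p \<in> layer j t"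
  shows "Du * p \<in> layer (Suc j) (t - 1)"
  using assms
proof (rule mult_layer)
  fix i k assume "j \<le> k" "int (i + k) = t"
  then show "Du * (Dy ^ i * Dx ^ k) \<in> layer (Suc j) (t - 1)"
    using Du_monomial[of i k] layer_antimono[of "Suc j" "Suc k"] by simp
qed

lemma Dxi_lower:
  assumes "Dxi * p - of_int a * p \<in> J"
  shows "Dxi * (Dy * p) - of_int (a - 2) * (Dy * p) \<in> J"
    and "Dxi * (Dx * p) - of_int (a - 2) * (Dx * p) \<in> J"
proof -
  have "r * (of_int a * p) = of_int a * (r * p)" for r
    by (metis mult_of_int_commute mult.assoc)
  then have "Dxi * (Dy * p) - of_int (a - 2) * (Dy * p) = Dy * (Dxi * p - of_int a * p)"
    and "Dxi * (Dx * p) - of_int (a - 2) * (Dx * p) = Dx * (Dxi * p - of_int a * p)"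
    by (simp_all add: Dxi_Dy Dxi_Dx right_diff_distrib left_diff_distrib)
  then show "Dxi * (Dy * p) - of_int (a - 2) * (Dy * p) \<in> J"
    and "Dxi * (Dx * p) - of_int (a - 2) * (Dx * p) \<in> J"
    using mult_mem[OF assms] by metis+
qed

lemma Dxi_monomial:
  "Dxi * (Dy ^ i * Dx ^ k) - of_int (N - 2 * int (i + k)) * (Dy ^ i * Dx ^ k) \<in> J"
proof (induction i)
  case 0
  show ?case
  proof (induction k)
    case 0
    show ?case using Dxi_mem by simp
  next
    case (Suc k)
    have "N - 2 * int (0 + Suc k) = N - 2 * int (0 + k) - 2" by simp
    then show ?case using Dxi_lower(2)[OF Suc] by (simp only: power_Suc power_0 mult_1_left)
  qed
next
  case (Suc i)
  have "N - 2 * int (Suc i + k) = N - 2 * int (i + k) - 2" by simp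
  then show ?case using Dxi_lower(1)[OF Suc] by (simp only: power_Suc mult.assoc)
qed

lemma Dxi_layer:
  assumes "p \<in> layer j t"
  shows "Dxi * p \<in> layer j t"
  using assms
proof (rule mult_layer)
  fix i k assume "j \<le> k" "int (i + k) = t"
  then have "Dy ^ i * Dx ^ k \<in> layer j t" by (intro monomial_in_layer)
  from layer_add[OF J_subset_layer[OF Dxi_monomial[of i k]] layer_scale[OF this, of "of_int (N - 2 * int (i + k))"]]
  show "Dxi * (Dy ^ i * Dx ^ k) \<in> layer j t" unfolding jd_scalar_of_int by simp
qed

text \<open>
  Together with the analogous facts for \<open>g\<close> and \<open>u\<close>, this says that every \<open>x\<^sup>k\<close> is again a highest
  weight vector modulo \<open>J\<close>: the commutator of \<open>v\<close> and \<open>x\<close> is \<open>1 - g + xu\<close>, which kills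
  \<open>x\<^sup>k\<close> modulo \<open>J\<close>.
\<close>
lemma Dv_Dx_power: "Dv * Dx ^ k \<in> J"
proof (induction k)
  case (Suc k)
  have "Dv * Dx ^ Suc k = Dx * (Dv * Dx ^ k) - Dx ^ k * (Dg - 1) + Dx * (Dx ^ k * (Du :: 'k jordan_double))"
    by (simp add: Dv_Dx algebra_simps Du_Dx_power Dg_Dx_power)
  also have "\<dots> \<in> J"
    by (intro add_mem diff_mem mult_mem Suc Dg_mem Du_mem)
  finally show ?case .
qed (simp add: Dv_mem)

text \<open>
  The coefficient of the raising operator on the \<open>i\<close>-th descendant of a highest weight vector of
  \<open>sl\<^sub>2\<close> of weight \<open>N - 2k\<close>. The factor \<open>\<onehalf>\<close> comes from the normalisation \<open>vy - yv = \<onehalf>g\<xi> + yu\<close>.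
\<close>
definition v_coeff :: "nat \<Rightarrow> nat \<Rightarrow> 'k" where
  "v_coeff i k = of_int (int i * (N - 2 * int k - int i + 1)) / 2"

text \<open>
  Passing one letter \<open>y\<close> contributes \<open>\<onehalf>g\<xi> + yu\<close>. Modulo the next step of the filtration \<open>g\<close> is \<open>1\<close>
  and \<open>u\<close> is \<open>0\<close>, so the contribution is half the weight, as for \<open>sl\<^sub>2\<close>. For \<open>i = 0\<close> the truncated
  exponent \<open>i - 1\<close> is harmless because the coefficient vanishes.
\<close>
lemma Dv_monomial:
  "Dv * (Dy ^ i * Dx ^ k) - jd_scalar (v_coeff i k) * (Dy ^ (i - 1) * Dx ^ k) \<in> layer (Suc k) (int (i + k) - 1)"
proof (induction i)
  case 0
  then show ?case by (simp add: v_coeff_def J_subset_layer Dv_Dx_power)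
next
  case (Suc i)
  define p where "p = Dy ^ i * (Dx ^ k :: 'k jordan_double)"
  define p' where "p' = Dy ^ (i - 1) * (Dx ^ k :: 'k jordan_double)"
  define c where "c = jd_scalar (v_coeff i k)"
  define \<mu> :: 'k where "\<mu> = of_int (N - 2 * int (i + k))"
  have p: "p \<in> layer k (int (i + k))" unfolding p_def by (rule monomial_in_layer) auto
  have "Dv * p - c * p' \<in> layer (Suc k) (int (i + k) - 1)" using Suc by (simp add: p_def p'_def c_def)
  from Dy_layer[OF this] have 1: "Dy * (Dv * p - c * p') \<in> layer (Suc k) (int (i + k))" by simp
  have 2: "jd_scalar (1 / 2) * (Dg * (Dxi * p - jd_scalar \<mu> * p)) \<in> layer (Suc k) (int (i + k))"
    using Dxi_monomial[of i k] unfolding \<mu>_def p_def jd_scalar_of_int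
    by (intro J_subset_layer mult_mem)
  have 3: "jd_scalar (1 / 2) * (jd_scalar \<mu> * ((Dg - 1) * p)) \<in> layer (Suc k) (int (i + k))"
    by (intro layer_scale Dg_layer p)
  have 4: "Dy * (Du * p) \<in> layer (Suc k) (int (i + k))"
    using Dy_layer[OF Du_layer[OF p]] by simp
  have cp: "Dy * (c * p') = c * p"
  proof (cases i)
    case 0
    then show ?thesis by (simp add: c_def v_coeff_def)
  next
    case (Suc a)
    have "Dy * (c * p') = c * (Dy * p')" by (metis c_def jd_scalar_commute mult.assoc)
    then show ?thesis by (simp add: p_def p'_def Suc mult.assoc)
  qed
  have "v_coeff (Suc i) k = v_coeff i k + 1 / 2 * \<mu>"
    unfolding v_coeff_def \<mu>_def by (simp add: field_simps)
  then have c: "jd_scalar (v_coeff (Suc i) k) = c + jd_scalar (1 / 2) * jd_scalar \<mu>"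
    by (simp only: c_def jd_scalar_add jd_scalar_mult)
  have comm: "Dg * (jd_scalar \<mu> * p) = jd_scalar \<mu> * (Dg * p)" by (metis jd_scalar_commute mult.assoc)
  have "Dv * (Dy * p) = Dy * (Dv * p) + jd_scalar (1 / 2) * (Dg * (Dxi * p)) + Dy * (Du * p)"
    by (rule Dv_Dy)
  then have "Dv * (Dy * p) - jd_scalar (v_coeff (Suc i) k) * p =
      Dy * (Dv * p - c * p') + jd_scalar (1 / 2) * (Dg * (Dxi * p - jd_scalar \<mu> * p))
      + jd_scalar (1 / 2) * (jd_scalar \<mu> * ((Dg - 1) * p)) + Dy * (Du * p)"
    unfolding c by (simp add: right_diff_distrib left_diff_distrib distrib_left distrib_right cp comm mult.assoc)
  also have "\<dots> \<in> layer (Suc k) (int (i + k))"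
    by (intro layer_add 1 2 3 4)
  finally show ?case by (simp add: p_def mult.assoc)
qed

lemma Dv_layer:
  assumes "p \<in> layer j t"
  shows "Dv * p \<in> layer j (t - 1)"
  using assms
proof (rule mult_layer)
  fix i k assume ik: "j \<le> k" "int (i + k) = t"
  have "jd_scalar (v_coeff i k) * (Dy ^ (i - 1) * Dx ^ k) \<in> layer j (t - 1)"
  proof (cases i)
    case 0
    then show ?thesis by (simp add: v_coeff_def layer_def regular.span_zero)
  next
    case (Suc a)
    then show ?thesis using ik by (intro layer_scale monomial_in_layer) auto
  qed
  moreover have "Dv * (Dy ^ i * Dx ^ k) - jd_scalar (v_coeff i k) * (Dy ^ (i - 1) * Dx ^ k) \<in> layer j (t - 1)"
    using Dv_monomial[of i k] ik layer_antimono[of j "Suc k"] by simp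
  ultimately show "Dv * (Dy ^ i * Dx ^ k) \<in> layer j (t - 1)"
    using layer_add by fastforce
qed

lemma sum_mem: "(\<And>a. a \<in> A \<Longrightarrow> f a \<in> J) \<Longrightarrow> sum f A \<in> J"
  by (rule regular.subspace_sum[OF subspace_left_ideal[OF left_ideal]])

text \<open>
  Eigenvectors of \<open>\<xi>\<close> for distinct eigenvalues are independent in the quotient by \<open>J\<close>: applying
  \<open>\<xi>\<close> minus the eigenvalue of \<open>b\<close> removes the summand of \<open>b\<close> and rescales the others by
  nonzero integers, which are invertible in characteristic \<open>0\<close>.
\<close>
lemma eigenvectors_mem:
  assumes "finite A" and "inj_on ev A"
    and "\<And>a. a \<in> A \<Longrightarrow> Dxi * w a - of_int (ev a) * w a \<in> J"
    and "sum w A \<in> J" and "a \<in> A"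
  shows "w a \<in> J"
  using assms
proof (induction A arbitrary: w a rule: finite_induct)
  case (insert b A)
  have comm: "r * (of_int c * p) = of_int c * (r * p)" for r p :: "'k jordan_double" and c
    by (metis mult_of_int_commute mult.assoc)
  define w' where "w' a = of_int (ev a - ev b) * w a" for a
  have "w' a = (Dxi * w a - of_int (ev b) * w a) - (Dxi * w a - of_int (ev a) * w a)" for a
    by (simp add: w'_def algebra_simps)
  then have "sum w' A = (\<Sum>a\<in>A. Dxi * w a - of_int (ev b) * w a) - (\<Sum>a\<in>A. Dxi * w a - of_int (ev a) * w a)"
    by (simp add: sum_subtractf)
  also have "\<dots> = (Dxi - of_int (ev b)) * sum w (insert b A)
      - (\<Sum>a\<in>insert b A. Dxi * w a - of_int (ev a) * w a)"
    using insert.hyps by (simp add: sum_distrib_left left_diff_distrib distrib_left)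
  also have "\<dots> \<in> J"
    using insert.prems by (intro diff_mem[OF mult_mem sum_mem])
  finally have w'_sum: "sum w' A \<in> J" .
  have w'_eigen: "Dxi * w' a - of_int (ev a) * w' a \<in> J" if "a \<in> A" for a
  proof -
    have "of_int (ev a - ev b) * (Dxi * w a - of_int (ev a) * w a) \<in> J"
      using that insert.prems by (intro mult_mem) simp
    also have "of_int (ev a - ev b) * (Dxi * w a - of_int (ev a) * w a) = Dxi * w' a - of_int (ev a) * w' a"
      unfolding w'_def comm[of Dxi] comm[of "of_int (ev a)"] by (simp only: right_diff_distrib)
    finally show ?thesis .
  qed
  have A: "w a \<in> J" if "a \<in> A" for a
  proof -
    have "w' a \<in> J"
      using insert.prems(1) insert.IH[OF _ w'_eigen w'_sum that] by (auto intro: inj_on_subset)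
    then have "jd_scalar (of_int (ev a - ev b)) * w a \<in> J" by (simp only: w'_def jd_scalar_of_int)
    moreover have "(of_int (ev a - ev b) :: 'k) \<noteq> 0"
      using insert.prems(1) insert.hyps that by (subst of_int_eq_0_iff) (auto simp: inj_on_def)
    ultimately show ?thesis by (rule cancel_scalar_mem)
  qed
  have "sum w (insert b A) - sum w A \<in> J"
    using A by (intro diff_mem[OF insert.prems(3) sum_mem])
  then have "w b \<in> J" using insert.hyps by simp
  then show ?case using A insert.prems by auto
qed simp

text \<open>
  Weights separate the degrees \<open>i + k\<close>. Within one degree the monomials lie at pairwise different
  depths \<open>k\<close> of the filtration, so the shallowest one with nonzero coefficient would be a combination
  of deeper ones, which the assumption excludes.
\<close>
lemma monomials_independent:
  assumes "finite U"
    and notin: "\<And>i k. (i, k) \<in> U \<Longrightarrow> Dy ^ i * Dx ^ k \<notin> layer (Suc k) (int (i + k))"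
    and sum: "(\<Sum>(i, k)\<in>U. jd_scalar (a i k) * (Dy ^ i * Dx ^ k)) \<in> J"
    and mem: "(i, k) \<in> U"
  shows "a i k = 0"
proof -
  define f where "f = (\<lambda>(i, k). jd_scalar (a i k) * (Dy ^ i * Dx ^ k))"
  define deg :: "nat \<times> nat \<Rightarrow> nat" where "deg = (\<lambda>(i, k). i + k)"
  define V where "V s = {u \<in> U. deg u = s}" for s
  have V_finite: "finite (V s)" for s using \<open>finite U\<close> by (simp add: V_def)
  have V_sum: "sum f (V s) \<in> J" if "s \<in> deg ` U" for s
  proof (rule eigenvectors_mem[where A = "deg ` U" and ev = "\<lambda>s. N - 2 * int s" and w = "\<lambda>s. sum f (V s)"])
    show "finite (deg ` U)" using \<open>finite U\<close> by simp
    show "inj_on (\<lambda>s. N - 2 * int s) (deg ` U)" by (auto simp: inj_on_def)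
    show "(\<Sum>s\<in>deg ` U. sum f (V s)) \<in> J"
      using sum sum.image_gen[OF \<open>finite U\<close>, of f deg] by (simp add: f_def V_def)
    show "s \<in> deg ` U" by (rule that)
    fix s
    have "Dxi * f u - of_int (N - 2 * int s) * f u \<in> J" if "u \<in> V s" for u
    proof -
      obtain i k where u: "u = (i, k)" "s = i + k" using \<open>u \<in> V s\<close> by (cases u) (auto simp: V_def deg_def)
      have "jd_scalar (a i k) * (Dxi * (Dy ^ i * Dx ^ k) - of_int (N - 2 * int (i + k)) * (Dy ^ i * Dx ^ k)) \<in> J"
        by (intro mult_mem Dxi_monomial)
      moreover have "Dxi * (jd_scalar (a i k) * p) = jd_scalar (a i k) * (Dxi * p)"
        "of_int c * (jd_scalar (a i k) * p) = jd_scalar (a i k) * (of_int c * p)" for p c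
        by (metis jd_scalar_commute mult.assoc)+
      ultimately show ?thesis by (simp only: f_def u prod.case right_diff_distrib)
    qed
    then show "Dxi * sum f (V s) - of_int (N - 2 * int s) * sum f (V s) \<in> J"
      unfolding sum_distrib_left sum_subtractf[symmetric] by (rule sum_mem)
  qed
  \<comment> \<open>Induction on the depth \<open>k\<close>: the shallowest monomials are treated first.\<close>
  show ?thesis using mem
  proof (induction k arbitrary: i rule: less_induct)
    case (less k)
    define s where "s = i + k"
    have ik: "(i, k) \<in> V s" using less.prems by (simp add: V_def deg_def s_def)
    \<comment> \<open>The shallower terms vanish by induction, and no other term of degree \<open>s\<close> has depth \<open>k\<close>.\<close>
    have "f u \<in> layer (Suc k) (int s)" if u: "u \<in> V s - {(i, k)}" for u
    proof -
      obtain i' k' where u': "u = (i', k')" "i' + k' = s" "(i', k') \<in> U"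
        using u by (cases u) (auto simp: V_def deg_def)
      have "k' \<noteq> k" using u u' by (auto simp: s_def)
      then consider "k' < k" | "Suc k \<le> k'" by linarith
      then show ?thesis
      proof cases
        case 1
        then show ?thesis
          using less.IH[of k' i'] u' by (simp add: f_def layer_def regular.span_zero)
      next
        case 2
        then show ?thesis
          unfolding f_def u' prod.case using u' by (intro layer_scale monomial_in_layer) auto
      qed
    qed
    then have "sum f (V s - {(i, k)}) \<in> layer (Suc k) (int s)"
      unfolding layer_def by (rule regular.span_sum)
    moreover have "sum f (V s) \<in> layer (Suc k) (int s)"
      using less.prems by (intro J_subset_layer V_sum) (auto simp: s_def deg_def image_iff intro!: bexI[of _ "(i, k)"])
    ultimately have "sum f (V s) - sum f (V s - {(i, k)}) \<in> layer (Suc k) (int s)"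
      by (metis layer_diff)
    moreover have "sum f (V s) = f (i, k) + sum f (V s - {(i, k)})"
      by (rule sum.remove[OF V_finite ik])
    ultimately have f_layer: "f (i, k) \<in> layer (Suc k) (int s)" by simp
    show "a i k = 0"
    proof (rule ccontr)
      assume "a i k \<noteq> 0"
      with f_layer have "Dy ^ i * Dx ^ k \<in> layer (Suc k) (int s)"
        unfolding f_def prod.case by (rule layer_cancel_scalar)
      then show False using notin[OF less.prems] by (simp add: s_def)
    qed
  qed
qed

lemma gen_layer:
  assumes "p \<in> layer j t"
  shows "\<exists>j' t'. jd_gen l * p \<in> layer j' t'"
proof (cases l)
  case Letter_g
  have "p + (Dg - 1) * p \<in> layer j t"
    using layer_antimono[OF _ Dg_layer[OF assms], of j] by (intro layer_add assms) simp
  then show ?thesis using Letter_g by (auto simp: algebra_simps)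
qed (use Du_layer[OF assms] Dv_layer[OF assms] Dxi_layer[OF assms] Dginv_layer[OF assms]
      Dx_layer[OF assms] Dy_layer[OF assms] in \<open>simp; blast\<close>)+

text \<open>
  Spanning half of a basis theorem modulo \<open>J\<close>: every generator maps each layer into a layer, and the
  layers consist of combinations of monomials.
\<close>
lemma span_monomials: "regular.span (J \<union> range (\<lambda>(i, k). Dy ^ i * Dx ^ k)) = UNIV"
  (is "regular.span ?G = UNIV")
proof -
  have layer_subset: "layer j t \<subseteq> regular.span ?G" for j t
    unfolding layer_def by (rule regular.span_mono) auto
  have "r \<in> regular.span ?G" for r
  proof (induction r rule: jordan_double_induct)
    case one
    show ?case by (rule regular.span_base) (auto intro!: image_eqI[of _ _ "(0, 0)"])
  next
    case (add p q)
    then show ?case by (rule regular.span_add)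
  next
    case (scale c p)
    then show ?case by (subst regular.scale_def[symmetric]) (rule regular.span_scale)
  next
    case (gen l p)
    then show ?case
    proof (induction rule: regular.span_induct_alt)
      case base
      show ?case by (simp add: regular.span_zero)
    next
      case (step c q p)
      have "jd_gen l * q \<in> regular.span ?G"
      proof (cases "q \<in> J")
        case True
        then show ?thesis by (intro regular.span_base) (simp add: mult_mem)
      next
        case False
        then obtain i k where "q = Dy ^ i * Dx ^ k" using step by auto
        then have "q \<in> layer k (int (i + k))" by (simp add: monomial_in_layer)
        then show ?thesis using gen_layer layer_subset by blast
      qed
      then show ?case
        using step unfolding distrib_left regular_scale_mult_right
        by (intro regular.span_add regular.span_scale)
    qed
  qed
  then show ?thesis by blast
qed

lemma monomial_expansion:
  obtains U a where "finite U" and "r - (\<Sum>(i, k)\<in>U. jd_scalar (a i k) * (Dy ^ i * Dx ^ k)) \<in> J"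
proof -
  let ?mon = "\<lambda>(i, k). Dy ^ i * Dx ^ k :: 'k jordan_double"
  have "r \<in> regular.span (J \<union> range ?mon)" using span_monomials by blast
  then obtain p q where r: "r = p + q" "p \<in> J" "q \<in> regular.span (range ?mon)"
    unfolding regular.span_Un span_J by blast
  then obtain t b where t: "finite t" "t \<subseteq> range ?mon" "q = (\<Sum>m\<in>t. regular.scale (b m) m)"
    unfolding regular.span_explicit by blast
  then obtain U where U: "inj_on ?mon U" "t = ?mon ` U" by (meson subset_image_inj)
  have "q = (\<Sum>u\<in>U. regular.scale (b (?mon u)) (?mon u))"
    unfolding t(3) U(2) by (simp add: sum.reindex[OF U(1)])
  also have "\<dots> = (\<Sum>(i, k)\<in>U. jd_scalar (b (Dy ^ i * Dx ^ k)) * (Dy ^ i * Dx ^ k))"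
    by (intro sum.cong) (auto simp: regular.scale_def)
  finally have "r - (\<Sum>(i, k)\<in>U. jd_scalar (b (Dy ^ i * Dx ^ k)) * (Dy ^ i * Dx ^ k)) \<in> J"
    using r by simp
  moreover have "finite U" using t(1) U finite_imageD by blast
  ultimately show thesis using that[of U "\<lambda>i k. b (Dy ^ i * Dx ^ k)"] by simp
qed

end

section \<open>Finite highest weight quotients are the modules T(n,m)\<close>

text \<open>
  These conditions hold when the quotient by \<open>J\<close> is nonzero and finite-dimensional, because the
  vectors \<open>x\<^sup>k\<close>, and for fixed \<open>k\<close> the vectors \<open>y\<^sup>i x\<^sup>k\<close>, have pairwise different weights.
\<close>
locale finite_highest_weight_ideal = highest_weight_ideal J N
  for J :: "'k::field_char_0 jordan_double set" and N :: int +
  assumes one_notin: "1 \<notin> J"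
    and Dx_nilpotent: "\<exists>k. Dx ^ k \<in> J"
    and Dy_nilpotent: "\<exists>i. Dy ^ i * Dx ^ k \<in> J"
begin

text \<open>
  The graded piece generated by a nonzero \<open>x\<^sup>k\<close> is a highest weight module over \<open>sl\<^sub>2\<close> of weight
  \<open>N - 2k\<close>. At the first power of \<open>y\<close> that vanishes in it, applying \<open>v\<close> forces the coefficient
  \<open>v_coeff\<close> to vanish, and this happens only for the exponent \<open>N - 2k + 1\<close>. In particular
  \<open>N - 2k\<close> cannot be negative.
\<close>
lemma string_length:
  assumes "Dx ^ k \<notin> J"
  obtains l where "int l = N - 2 * int k" "Dy ^ Suc l * Dx ^ k \<in> layer (Suc k) (int (Suc l + k))"
    "\<And>i. i \<le> l \<Longrightarrow> Dy ^ i * Dx ^ k \<notin> layer (Suc k) (int (i + k))"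
proof -
  let ?P = "\<lambda>i. Dy ^ i * Dx ^ k \<in> layer (Suc k) (int (i + k))"
  obtain i where "?P i" using Dy_nilpotent J_subset_layer by blast
  moreover have "\<not> ?P 0" using assms layer_eq_J[of "int k" "Suc k"] by simp
  ultimately obtain l where l: "\<not> ?P l" "?P (Suc l)" "\<And>i. i \<le> l \<Longrightarrow> \<not> ?P i"
    using ex_least_nat_less[of ?P i] by (metis le_less_linear less_Suc_eq_le)
  have "Dv * (Dy ^ Suc l * Dx ^ k) \<in> layer (Suc k) (int (l + k))"
    using Dv_layer[OF l(2)] by simp
  moreover have "Dv * (Dy ^ Suc l * Dx ^ k) - jd_scalar (v_coeff (Suc l) k) * (Dy ^ l * Dx ^ k)
      \<in> layer (Suc k) (int (l + k))"
    using Dv_monomial[of "Suc l" k] by simp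
  ultimately have "Dv * (Dy ^ Suc l * Dx ^ k) - (Dv * (Dy ^ Suc l * Dx ^ k)
      - jd_scalar (v_coeff (Suc l) k) * (Dy ^ l * Dx ^ k)) \<in> layer (Suc k) (int (l + k))"
    by (rule layer_diff)
  then have *: "jd_scalar (v_coeff (Suc l) k) * (Dy ^ l * Dx ^ k) \<in> layer (Suc k) (int (l + k))"
    by simp
  have "v_coeff (Suc l) k = 0"
    using layer_cancel_scalar[OF *] l(1) by auto
  then have "int (Suc l) * (N - 2 * int k - int (Suc l) + 1) = 0"
    unfolding v_coeff_def divide_eq_0_iff of_int_eq_0_iff by simp
  then have "int l = N - 2 * int k" by simp
  then show thesis using that l by blast
qed

lemma Dx_power_mem_mono: "Dx ^ k \<in> J \<Longrightarrow> k \<le> k' \<Longrightarrow> Dx ^ k' \<in> J"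
  using mult_mem[of "Dx ^ k" "Dx ^ (k' - k)"] by (simp add: power_add[symmetric])

text \<open>
  A priori \<open>y\<^sup>i x\<^sup>k\<close> with \<open>i = N - 2k + 1\<close> only lies one step deeper in the filtration. A deeper
  monomial of the same degree \<open>i + k = i' + k'\<close> with \<open>k' > k\<close> has \<open>i' > N - 2k'\<close>, so descending
  induction on \<open>k\<close> shows that all of them are zero: the strings of the deeper pieces are too short to
  reach the weight in question.
\<close>
lemma monomial_mem:
  assumes "int i > N - 2 * int k"
  shows "Dy ^ i * Dx ^ k \<in> J"
proof -
  obtain M where M: "Dx ^ M \<in> J" using Dx_nilpotent by blast
  show ?thesis using assms
  proof (induction "M - k" arbitrary: i k rule: less_induct)
    case less
    show ?case
    proof (cases "Dx ^ k \<in> J")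
      case True
      then show ?thesis by (rule mult_mem)
    next
      case False
      then have "k < M" using Dx_power_mem_mono[OF M, of k] by linarith
      obtain l where l: "int l = N - 2 * int k" "Dy ^ Suc l * Dx ^ k \<in> layer (Suc k) (int (Suc l + k))"
        using string_length[OF False] by metis
      have "Dy ^ i' * Dx ^ k' \<in> J" if "Suc k \<le> k'" "int (i' + k') = int (Suc l + k)" for i' k'
        using that l \<open>k < M\<close> by (intro less.hyps) auto
      then have "layer (Suc k) (int (Suc l + k)) \<subseteq> regular.span J"
        unfolding layer_def by (intro regular.span_mono) auto
      then have "Dy ^ Suc l * Dx ^ k \<in> J"
        using l(2) span_J by blast
      then have "Dy ^ (i - Suc l) * (Dy ^ Suc l * Dx ^ k) \<in> J"
        by (rule mult_mem)
      also have "Dy ^ (i - Suc l) * (Dy ^ Suc l * Dx ^ k) = Dy ^ i * Dx ^ k"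
        using less.prems l by (simp only: mult.assoc[symmetric] power_add[symmetric]) simp
      finally show ?thesis .
    qed
  qed
qed

text \<open>
  Here \<open>m\<close> is the last exponent with \<open>x\<^sup>m\<close> nonzero modulo \<open>J\<close>, and \<open>n = N - 2m\<close> is its weight.
  The relators of \<open>T(n,m)\<close> then lie in \<open>J\<close>. Conversely, modulo the ideal \<open>I\<close> of \<open>T(n,m)\<close> every element
  is a combination of the monomials \<open>y\<^sup>i x\<^sup>k\<close> that the relators do not kill, and these are
  independent even modulo the larger ideal \<open>J\<close>.
\<close>
theorem eq_T_ideal: "\<exists>n m. J = T_ideal n m"
proof -
  define m where "m = (LEAST k. Dx ^ k \<in> J) - 1"
  have least: "Dx ^ (LEAST k. Dx ^ k \<in> J) \<in> J" using Dx_nilpotent by (rule LeastI_ex)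
  then have "(LEAST k. Dx ^ k \<in> J) \<noteq> 0" using one_notin by (metis power_0)
  then have Suc_m: "(LEAST k. Dx ^ k \<in> J) = Suc m" by (simp add: m_def)
  then have m_mem: "Dx ^ Suc m \<in> J" using least by simp
  have m_notin: "Dx ^ k \<notin> J" if "k \<le> m" for k
    using not_less_Least[of k "\<lambda>k. Dx ^ k \<in> J"] that Suc_m by simp
  obtain n where n: "int n = N - 2 * int m" using string_length[OF m_notin[OF order_refl]] by metis
  define I :: "'k jordan_double set" where "I = T_ideal n m"
  have N: "of_int N = (of_nat (n + 2 * m) :: 'k jordan_double)"
    using n by (metis add.commute diff_add_cancel of_int_of_nat_eq of_nat_add of_nat_mult of_nat_numeral)
  have "T_relators n m \<subseteq> J"
  proof
    fix r :: "'k jordan_double" assume "r \<in> T_relators n m"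
    then consider "r \<in> {Dg - 1, Dxi - of_int N, Du, Dv, Dx ^ Suc m}"
      | j where "j \<le> m" "r = Dy ^ (n + 2 * (m - j) + 1) * Dx ^ j"
      unfolding T_relators_def N by auto
    then show "r \<in> J"
    proof cases
      case 1
      then show ?thesis using Dg_mem Dxi_mem Du_mem Dv_mem m_mem by blast
    next
      case 2
      show ?thesis unfolding 2(2) by (rule monomial_mem) (use 2(1) n in simp)
    qed
  qed
  then have "I \<subseteq> J" unfolding I_def T_ideal_def by (intro hull_minimal left_ideal)
  have relators: "r \<in> I" if "r \<in> T_relators n m" for r
    using that unfolding I_def T_ideal_def by (rule hull_inc)
  interpret I: highest_weight_ideal I N
  proof
    show "left_ideal I" unfolding I_def T_ideal_def by (rule left_ideal_hull)
  qed (intro relators; simp add: T_relators_def N)+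
  have mem_I: "Dy ^ i * Dx ^ k \<in> I" if "\<not> (k \<le> m \<and> i \<le> n + 2 * (m - k))" for i k
  proof (cases "k \<le> m")
    case True
    have "Dy ^ (i - (n + 2 * (m - k) + 1)) * (Dy ^ (n + 2 * (m - k) + 1) * Dx ^ k) \<in> I"
      using True by (intro I.mult_mem relators) (auto simp: T_relators_def)
    also have "Dy ^ (i - (n + 2 * (m - k) + 1)) * (Dy ^ (n + 2 * (m - k) + 1) * Dx ^ k) = Dy ^ i * (Dx ^ k :: 'k jordan_double)"
      using True that by (simp only: mult.assoc[symmetric] power_add[symmetric]) simp
    finally show ?thesis .
  next
    case False
    have "(Dy ^ i * Dx ^ (k - Suc m)) * Dx ^ Suc m \<in> I"
      by (intro I.mult_mem relators) (simp add: T_relators_def)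
    also have "(Dy ^ i * Dx ^ (k - Suc m)) * Dx ^ Suc m = Dy ^ i * (Dx ^ k :: 'k jordan_double)"
      using False by (simp only: mult.assoc power_add[symmetric]) simp
    finally show ?thesis .
  qed
  have "J \<subseteq> I"
  proof
    fix r assume "r \<in> J"
    obtain U a where U: "finite U" "r - (\<Sum>(i, k)\<in>U. jd_scalar (a i k) * (Dy ^ i * Dx ^ k)) \<in> I"
      by (rule I.monomial_expansion)
    define f where "f = (\<lambda>(i, k). jd_scalar (a i k) * (Dy ^ i * Dx ^ k))"
    define R where "R = {(i, k). k \<le> m \<and> i \<le> n + 2 * (m - k)}"
    have "sum f (U - R) \<in> I"
      by (rule I.sum_mem) (auto simp: f_def R_def intro!: I.mult_mem mem_I)
    moreover have "sum f U = sum f (U \<inter> R) + sum f (U - R)"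
      using sum.Int_Diff[OF U(1), of f R] .
    moreover have "r - sum f U \<in> I" using U(2) by (simp add: f_def)
    ultimately have rI: "r - sum f (U \<inter> R) \<in> I"
      using I.add_mem[of "r - sum f U" "sum f (U - R)"] by simp
    have "r - (r - sum f (U \<inter> R)) \<in> J"
      by (rule diff_mem[OF \<open>r \<in> J\<close> subsetD[OF \<open>I \<subseteq> J\<close> rI]])
    then have UR: "(\<Sum>(i, k)\<in>U \<inter> R. jd_scalar (a i k) * (Dy ^ i * Dx ^ k)) \<in> J" by (simp add: f_def)
    have "Dy ^ i * Dx ^ k \<notin> layer (Suc k) (int (i + k))" if ik: "(i, k) \<in> U \<inter> R" for i k
    proof -
      have k: "k \<le> m" "i \<le> n + 2 * (m - k)" using ik by (auto simp: R_def)
      obtain l where "int l = N - 2 * int k" "\<And>i. i \<le> l \<Longrightarrow> Dy ^ i * Dx ^ k \<notin> layer (Suc k) (int (i + k))"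
        using string_length[OF m_notin[OF k(1)]] by metis
      moreover from this have "i \<le> l" using k n by simp
      ultimately show ?thesis by blast
    qed
    then have "a i k = 0" if "(i, k) \<in> U \<inter> R" for i k
      using monomials_independent[OF _ _ UR that] U(1) by blast
    then have "sum f (U \<inter> R) = 0"
      by (intro sum.neutral) (auto simp: f_def)
    then show "r \<in> I" using rI by simp
  qed
  then show ?thesis using \<open>I \<subseteq> J\<close> I_def by blast
qed

end

section \<open>The annihilator of a highest weight vector\<close>

context left_module
begin

lemma act_zero_left: "act 0 m = 0"
  using act_add_left[of 0 0 m] by simp

lemma act_zero_right: "act r 0 = 0"
  using act_add_right[of r 0 0] by simp

lemma act_diff_left: "act (r - s) m = act r m - act s m"
  using act_add_left[of "r - s" s m] by (simp add: algebra_simps)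

lemma act_sum_left: "act (sum f A) m = (\<Sum>a\<in>A. act (f a) m)"
  by (induction A rule: infinite_finite_induct) (simp_all add: act_zero_left act_add_left)

lemma left_ideal_annihilator: "left_ideal {r. act r z = 0}"
  by (simp add: left_ideal_iff act_zero_left act_add_left act_mult act_zero_right)

lemma iso_quotient_by_annihilator:
  assumes generated: "\<And>m. \<exists>r. act r z = m"
  defines "J \<equiv> {r. act r z = 0}"
  shows "left_module_iso UNIV (+) act (coset_carrier J) (coset_add J) (coset_act J)"
proof -
  have J: "left_ideal J" unfolding J_def by (rule left_ideal_annihilator)
  have coset: "coset_rel J `` {r} = {s. act s z = act r z}" for r
    by (auto simp: coset_rel_def J_def act_diff_left)
  \<comment> \<open>The inverse of the map induced by \<open>r \<mapsto> r z\<close>: the fibres of that map are the cosets of \<open>J\<close>.\<close>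
  define f where "f m = {r. act r z = m}" for m
  have f_act: "f (act r z) = coset_rel J `` {r}" for r by (simp add: f_def coset)
  show ?thesis unfolding left_module_iso_def
  proof (intro exI[of _ f] conjI ballI allI)
    show "bij_betw f UNIV (coset_carrier J)"
    proof (rule bij_betwI')
      show "f m = f m' \<longleftrightarrow> m = m'" for m m'
        using generated[of m] by (auto simp: f_def)
      show "f m \<in> coset_carrier J" for m
        using generated[of m] f_act by (auto simp: coset_carrier_def quotient_def)
      show "\<exists>m\<in>UNIV. C = f m" if C: "C \<in> coset_carrier J" for C
        using that f_act by (auto simp: coset_carrier_def quotient_def)
    qed
    show "f (m + m') = coset_add J (f m) (f m')" for m m'
    proof -
      obtain r r' where m: "m = act r z" "m' = act r' z" using generated by metis
      show ?thesis
        by (simp only: m act_add_left[symmetric] f_act coset_add_coset[OF J])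
    qed
    show "f (act r m) = coset_act J r (f m)" for r m
    proof -
      obtain s where m: "m = act s z" using generated by metis
      show ?thesis
        by (simp only: m act_mult[symmetric] f_act coset_act_coset[OF J])
    qed
  qed
qed

end

text \<open>
  The top weight space is a line, stable under \<open>g\<close> and \<open>\<xi>\<close>, on which \<open>g - 1\<close> and \<open>\<xi>\<close> minus the
  weight are nilpotent, hence zero. As \<open>u\<close> and \<open>v\<close> raise the weight by \<open>2\<close>, they kill this line.
\<close>
lemma (in jordan_double_module) highest_weight_vector:
  assumes hwm: "highest_weight_module" and rk: "hw_rk = 1"
  obtains z where "z \<noteq> 0" and "\<And>m. \<exists>r. act r z = m"
    and "act (Dg - 1) z = 0" and "act (Dxi - of_int hw) z = 0" and "act Du z = 0" and "act Dv z = 0"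
proof -
  obtain B where B: "B \<subseteq> weight_space hw" "independent B" "weight_space hw \<subseteq> span B" "card B = 1"
    using rk basis_exists[of "weight_space hw"] unfolding hw_rk_def by metis
  obtain z where z: "B = {z}" using B(4) by (auto simp: card_1_singleton_iff)
  have z_mem: "z \<in> weight_space hw" using B z by simp
  have "z \<noteq> 0" using B(2) z dependent_zero by blast
  have multiple: "\<exists>c. m = scale c z" if "m \<in> weight_space hw" for m
    using that B(3) by (auto simp: z span_singleton)
  have "submodule {m. \<exists>r. act r z = m}"
    unfolding submodule_def by (auto simp: act_mult[symmetric] act_add_left[symmetric] intro: exI[of _ 0] act_zero_left)
  moreover have "weight_space hw \<subseteq> {m. \<exists>r. act r z = m}"
    using multiple by (auto simp: scale_def)
  ultimately have "submodule hull weight_space hw \<subseteq> {m. \<exists>r. act r z = m}"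
    by (rule hull_minimal[rotated])
  then have generated: "\<exists>r. act r z = m" for m
    using hwm by (auto simp: highest_weight_module_def)
  have commute: "(Dg - 1) * (Dxi - of_int hw) = (Dxi - of_int hw) * (Dg - 1 :: 'k jordan_double)"
    using Dxi_Dg[of "1 :: 'k jordan_double"] mult_of_int_commute[of hw "Dg :: 'k jordan_double"] by (simp add: algebra_simps)
  obtain a b where ab: "act ((Dxi - of_int hw) ^ a) z = 0" "act ((Dg - 1) ^ b) z = 0"
    using z_mem by (auto simp: weight_space_def)
  have nilpotent_imp_zero: "act r z = 0" if r: "act r z \<in> weight_space hw" "act (r ^ n) z = 0" for r n
  proof -
    obtain c where c: "act r z = scale c z" using multiple[OF r(1)] by blast
    have "act (r ^ n) z = scale (c ^ n) z"
    proof (induction n)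
      case 0
      then show ?case by (simp add: act_one)
    next
      case (Suc n)
      have "act (r ^ Suc n) z = act r (act (jd_scalar (c ^ n)) z)"
        using Suc by (simp add: act_mult scale_def)
      also have "\<dots> = act (jd_scalar (c ^ n)) (act r z)"
        by (simp only: act_mult[symmetric] jd_scalar_commute)
      finally show ?case by (simp add: c scale_def act_mult[symmetric] jd_scalar_mult[symmetric] mult.commute)
    qed
    then have "c = 0" using r \<open>z \<noteq> 0\<close> by simp
    then show ?thesis using c by simp
  qed
  have g: "act (Dg - 1) z = 0"
  proof (rule nilpotent_imp_zero[OF _ ab(2)])
    have "act ((Dxi - of_int hw) ^ a) (act (Dg - 1) z) = act (Dg - 1) (act ((Dxi - of_int hw) ^ a) z)"
      by (simp only: act_mult[symmetric] power_commuting_commutes[OF commute[symmetric]])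
    moreover have "act ((Dg - 1) ^ b) (act (Dg - 1) z) = act (Dg - 1) (act ((Dg - 1) ^ b) z)"
      by (simp only: act_mult[symmetric] power_commutes)
    ultimately show "act (Dg - 1) z \<in> weight_space hw"
      using ab by (auto simp: weight_space_def act_zero_right)
  qed
  have xi: "act (Dxi - of_int hw) z = 0"
  proof (rule nilpotent_imp_zero[OF _ ab(1)])
    have "act ((Dxi - of_int hw) ^ a) (act (Dxi - of_int hw) z) = act (Dxi - of_int hw) (act ((Dxi - of_int hw) ^ a) z)"
      by (simp only: act_mult[symmetric] power_commutes)
    moreover have "act ((Dg - 1) ^ b) (act (Dxi - of_int hw) z) = act (Dxi - of_int hw) (act ((Dg - 1) ^ b) z)"
      by (simp only: act_mult[symmetric] power_commuting_commutes[OF commute])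
    ultimately show "act (Dxi - of_int hw) z \<in> weight_space hw"
      using ab by (auto simp: weight_space_def act_zero_right)
  qed
  \<comment> \<open>The weight \<open>hw + 2\<close> exceeds the largest weight.\<close>
  have above_hw: "m = 0" if "act (Dxi - of_int (hw + 2)) m = 0" "act (Dg - 1) m = 0" for m
  proof (rule ccontr)
    assume "m \<noteq> 0"
    have "m \<in> weight_space (hw + 2)"
      unfolding weight_space_def using that by (auto intro!: exI[of _ 1])
    then have "hw + 2 \<in> weights" using \<open>m \<noteq> 0\<close> by (auto simp: weights_def)
    then have "hw + 2 \<le> hw"
      using hwm unfolding highest_weight_module_def hw_def by (intro cSup_upper) auto
    then show False by simp
  qed
  have u: "act Du z = 0"
  proof (rule above_hw)
    have xi_u: "(Dxi - of_int (hw + 2)) * Du = Du * (Dxi - of_int hw :: 'k jordan_double)"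
      using Dxi_Du[of "1 :: 'k jordan_double"] mult_of_int_commute[of hw "Du :: 'k jordan_double"]
      by (simp add: algebra_simps)
    show "act (Dxi - of_int (hw + 2)) (act Du z) = 0"
      by (simp only: act_mult[symmetric] xi_u) (simp only: act_mult xi act_zero_right)
    have g_u: "(Dg - 1) * Du = Du * (Dg - 1 :: 'k jordan_double)"
      using Dg_Du[of "1 :: 'k jordan_double"] by (simp add: algebra_simps)
    show "act (Dg - 1) (act Du z) = 0"
      by (simp only: act_mult[symmetric] g_u) (simp only: act_mult g act_zero_right)
  qed
  have v: "act Dv z = 0"
  proof (rule above_hw)
    have xi_v: "(Dxi - of_int (hw + 2)) * Dv = Dv * (Dxi - of_int hw :: 'k jordan_double)"
      using Dxi_Dv[of "1 :: 'k jordan_double"] mult_of_int_commute[of hw "Dv :: 'k jordan_double"]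
      by (simp add: algebra_simps)
    show "act (Dxi - of_int (hw + 2)) (act Dv z) = 0"
      by (simp only: act_mult[symmetric] xi_v) (simp only: act_mult xi act_zero_right)
    have g_v: "(Dg - 1) * Dv = Dv * (Dg - 1 :: 'k jordan_double) - Dg * Du"
      using Dg_Dv[of "1 :: 'k jordan_double"] by (simp add: algebra_simps)
    show "act (Dg - 1) (act Dv z) = 0"
      by (simp only: act_mult[symmetric] g_v) (simp only: act_diff_left[of "_ * _" "_ * _"] act_mult g u act_zero_right diff_self)
  qed
  show thesis by (rule that[OF \<open>z \<noteq> 0\<close> generated g xi u v])
qed

text \<open>
  Nonzero eigenvectors of \<open>\<xi>\<close> for infinitely many eigenvalues would be an infinite independent set
  in a finite-dimensional space.
\<close>
lemma eigenvector_sequence_annihilates: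
  fixes act :: "'k::field_char_0 jordan_double \<Rightarrow> 'm::ab_group_add \<Rightarrow> 'm" and w :: "nat \<Rightarrow> 'k jordan_double"
  assumes "jordan_double_module act" and fd: "jordan_double_module.finite_dim act UNIV"
    and J: "highest_weight_ideal {r. act r z = 0} N"
    and eigen: "\<And>n. act (Dxi * w n - of_int (ev n) * w n) z = 0" and "inj ev"
  shows "\<exists>n. act (w n) z = 0"
proof (rule ccontr)
  assume nz: "\<nexists>n. act (w n) z = 0"
  interpret jordan_double_module act by fact
  define J where "J = {r. act r z = 0}"
  interpret J: highest_weight_ideal J N unfolding J_def by (rule J)
  define f where "f n = act (w n) z" for n
  have w_notin: "w n \<notin> J" for n using nz by (simp add: J_def)
  have w_eigen: "Dxi * w n - of_int (ev n) * w n \<in> J" for n using eigen by (simp add: J_def)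
  have "inj f"
  proof (rule injI, rule ccontr)
    fix a b assume "f a = f b" "a \<noteq> b"
    then have "w a - w b \<in> J" by (simp add: J_def f_def act_diff_left)
    then have "(Dxi - of_int (ev a)) * (w a - w b) - (Dxi * w a - of_int (ev a) * w a)
        + (Dxi * w b - of_int (ev b) * w b) \<in> J"
      by (intro J.add_mem[OF J.diff_mem[OF J.mult_mem]] w_eigen)
    also have "(Dxi - of_int (ev a)) * (w a - w b) - (Dxi * w a - of_int (ev a) * w a)
        + (Dxi * w b - of_int (ev b) * w b) = jd_scalar (of_int (ev a - ev b)) * w b"
      unfolding jd_scalar_of_int by (simp add: algebra_simps)
    finally have "w b \<in> J"
      by (rule J.cancel_scalar_mem) (use \<open>inj ev\<close> \<open>a \<noteq> b\<close> in \<open>auto simp: inj_def\<close>)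
    then show False using w_notin by blast
  qed
  have "independent (range f)"
    unfolding dependent_explicit
  proof clarify
    fix V c v assume V: "finite V" "V \<subseteq> range f" "(\<Sum>v\<in>V. scale (c v) v) = 0" "v \<in> V" "c v \<noteq> 0"
    define A where "A = f -` V"
    have A: "finite A" "V = f ` A"
      using V \<open>inj f\<close> by (auto simp: A_def intro: finite_vimageI)
    have "(\<Sum>v\<in>V. scale (c v) v) = act (\<Sum>a\<in>A. jd_scalar (c (f a)) * w a) z"
      unfolding A(2) sum.reindex[OF inj_on_subset[OF \<open>inj f\<close> subset_UNIV]]
      by (simp add: act_sum_left act_mult scale_def f_def)
    then have sum: "(\<Sum>a\<in>A. jd_scalar (c (f a)) * w a) \<in> J" using V by (simp add: J_def)
    have c_eigen: "Dxi * (jd_scalar c * w a) - of_int (ev a) * (jd_scalar c * w a) \<in> J" for a c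
    proof -
      have "r * (jd_scalar c * p) = jd_scalar c * (r * p)" for r p
        by (metis jd_scalar_commute mult.assoc)
      then have "Dxi * (jd_scalar c * w a) - of_int (ev a) * (jd_scalar c * w a)
          = jd_scalar c * (Dxi * w a - of_int (ev a) * w a)"
        by (simp add: right_diff_distrib)
      then show ?thesis using J.mult_mem[OF w_eigen] by metis
    qed
    obtain a where a: "a \<in> A" "v = f a" using A V by blast
    have "jd_scalar (c (f a)) * w a \<in> J"
      by (rule J.eigenvectors_mem[OF A(1) inj_on_subset[OF \<open>inj ev\<close> subset_UNIV] c_eigen sum a(1)])
    then show False using J.cancel_scalar_mem w_notin V a by blast
  qed
  moreover obtain B where "finite B" "span B = UNIV" using fd by (auto simp: finite_dim_def)
  ultimately have "finite (range f)" using independent_span_bound[of B "range f"] by simp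
  then show False using \<open>inj f\<close> range_inj_infinite by blast
qed

theorem theorem4p7:
  fixes act :: "'k::{alg_closed_field, field_char_0} jordan_double \<Rightarrow> 'm::ab_group_add \<Rightarrow> 'm"
  assumes "jordan_double_module act"
    and "jordan_double_module.finite_dim act UNIV"
    and "left_module.indecomposable act"
    and "jordan_double_module.highest_weight_module act"
    and "jordan_double_module.hw_rk act = 1"
  shows "\<exists>n m :: nat.
    left_module_iso UNIV (+) act
      (coset_carrier (T_ideal n m)) (coset_add (T_ideal n m)) (coset_act (T_ideal n m))"
proof -
  interpret jordan_double_module act by fact
  obtain z where z: "z \<noteq> 0" "\<And>m. \<exists>r. act r z = m" "act (Dg - 1) z = 0"
    "act (Dxi - of_int hw) z = 0" "act Du z = 0" "act Dv z = 0"
    using highest_weight_vector assms(4,5) by metis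
  define J where "J = {r. act r z = 0}"
  have J: "highest_weight_ideal J hw"
    by standard (use left_ideal_annihilator z in \<open>simp_all add: J_def\<close>)
  interpret highest_weight_ideal J hw by (rule J)
  note vanishing = eigenvector_sequence_annihilates[OF assms(1,2) J[unfolded J_def]]
  interpret finite_highest_weight_ideal J hw
  proof
    show "1 \<notin> J" using z(1) by (simp add: J_def act_one)
    have "act (Dxi * Dx ^ k - of_int (hw - 2 * int k) * Dx ^ k) z = 0" for k
      using Dxi_monomial[of 0 k] by (simp add: J_def)
    then have "\<exists>k. act (Dx ^ k) z = 0"
      by (rule vanishing) (simp add: inj_def)
    then show "\<exists>k. Dx ^ k \<in> J" by (simp add: J_def)
    have "act (Dxi * (Dy ^ i * Dx ^ k) - of_int (hw - 2 * int (i + k)) * (Dy ^ i * Dx ^ k)) z = 0" for i k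
      using Dxi_monomial[of i k] by (simp add: J_def)
    then have "\<exists>i. act (Dy ^ i * Dx ^ k) z = 0" for k
      by (rule vanishing) (simp add: inj_def)
    then show "\<exists>i. Dy ^ i * Dx ^ k \<in> J" for k by (simp add: J_def)
  qed
  obtain n m where "J = T_ideal n m" using eq_T_ideal by blast
  then show ?thesis
    using iso_quotient_by_annihilator[OF z(2)] J_def by metis
qed

end
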